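(* Let $q\in\mathbb{C}^*$ with $|q|<1$, let $\underline z=(z_1,\ldots,z_{\ell+1})$ with $z_j=e^{\lambda_j}$, and let $n,k\in\mathbb{Z}$. The specialized class one $q$-deformed $\mathfrak{gl}_{\ell+1}$-Whittaker function can be written in the following form: $$\Psi^{\mathfrak{gl}_{\ell+1}}_{\underline z}(n,k)\,=\,\langle I_{n,k}(\underline z)\,\tilde L(\underline z),[\mathbb{P}^\ell]\rangle_K,$$ where $$\tilde L(\underline z,t)=\frac{1}{\prod_{j=1}^{\ell+1}\prod_{m=1}^\infty(1-tz_jq^m)}=\prod_{j=1}^{\ell+1}\Gamma_q(qtz_j),$$ $$I_{n,k}(\underline z,t)=\Big(\prod_{j=1}^{\ell+1}z_j^k\Big)\,t^{-n}\sum_{i=0}^\infty q^{ni}\,\frac{1}{\prod_{j=1}^{\ell+1}\prod_{m=1}^i(1-tz_jq^{-m})},$$ and $\langle\,,\,\rangle_K$ is the standard pairing on $K_{U_{\ell+1}}(\mathbb{P}^\ell)$ taking values in $K_{U_{\ell+1}}(\mathrm{pt})$, given by the contour integral in the context.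
   Context: Notation: $(m)_q!=\prod_{j=1}^m(1-q^j)$ for $m\ge 0$ (so $(0)_q!=1$), and $\Gamma_q(x)=\prod_{m=0}^\infty\frac{1}{1-q^mx}$. Whittaker function. For $\underline p=(p_1,\ldots,p_{\ell+1})\in\mathbb{Z}^{\ell+1}$ with $p_1\ge\cdots\ge p_{\ell+1}$, put $p_{\ell+1,i}=p_i$ and define $$\Psi^{\mathfrak{gl}_{\ell+1}}_{\underline z}(\underline p)=\sum\ \prod_{r=1}^{\ell+1}z_r^{\sum_{i=1}^{r}p_{r,i}-\sum_{i=1}^{r-1}p_{r-1,i}}\ \frac{\prod_{r=2}^{\ell}\prod_{i=1}^{r-1}(p_{r,i}-p_{r,i+1})_q!}{\prod_{r=1}^{\ell}\prod_{i=1}^{r}(p_{r+1,i}-p_{r,i})_q!\,(p_{r,i}-p_{r+1,i+1})_q!},$$ the sum being over all integer arrays $(p_{r,i})_{1\le i\le r\le \ell}$ satisfying $p_{r+1,i}\ge p_{r,i}\ge p_{r+1,i+1}$ for $1\le i\le r\le\ell$. Put $\Psi^{\mathfrak{gl}_{\ell+1}}_{\underline z}(\underline p)=0$ if $p_1\ge\cdots\ge p_{\ell+1}$ fails. The specialized function is $\Psi^{\mathfrak{gl}_{\ell+1}}_{\underline z}(n,k):=\Psi^{\mathfrak{gl}_{\ell+1}}_{\underline z}(n+k,k,\ldots,k)$. Pairing. One uses the model $K_{U_{\ell+1}}(\mathbb{P}^\ell)=\mathbb{C}[t,t^{-1},z,z^{-1}]/\prod_{j=1}^{\ell+1}(1-tz_j)$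 of the $U_{\ell+1}$-equivariant $K$-theory of $\mathbb{P}^\ell$, where $t$ is the class of a line bundle and $z_1,\ldots,z_{\ell+1}$ are the equivariant parameters. The pairing of a class represented by a rational function $R(t)$ with the fundamental class of $\mathbb{P}^\ell$ is $$\langle R,[\mathbb{P}^\ell]\rangle_K=-\frac{1}{2\pi\imath}\oint_{C_0}\frac{dt}{t}\,\frac{R(t)}{\prod_{j=1}^{\ell+1}(1-tz_j)},$$ where the integration contour $C_0$ encircles the $\ell+1$ poles $t=z_j^{-1}$, $j=1,\ldots,\ell+1$. In the claim the same contour integral formula is applied to $R(t)=I_{n,k}(\underline z,t)\,\tilde L(\underline z,t)$.
   Formalization: Assumes ℓ ≥ 1 (the formula fails for ℓ = 0) and that C_0 encircles the poles z_j^{-1} but neither 0 nor any point z_j^{-1}q^m with m ≠ 0, so the formula is claimed only when z_i^{-1} ≠ z_j^{-1}q^m for all i, j and m ≠ 0; it fails for resonant z. *)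

theory Defs
  imports "HOL-Complex_Analysis.Complex_Analysis"
begin

section \<open>\<open>q\<close>-factorial and \<open>q\<close>-Gamma function\<close>

text \<open>The factorials in the Whittaker function are taken of differences of integers that are
  nonnegative on the range of summation, so they are defined on \<open>int\<close> through \<open>nat\<close>.\<close>

definition q_fact :: "complex \<Rightarrow> int \<Rightarrow> complex" where
  "q_fact q m = (\<Prod>j=1..nat m. 1 - q ^ j)"

definition q_Gamma :: "complex \<Rightarrow> complex \<Rightarrow> complex" where
  "q_Gamma q x = (\<Prod>m. 1 / (1 - q ^ m * x))"

section \<open>The class one \<open>q\<close>-deformed Whittaker function\<close>

text \<open>Arrays \<open>P r i\<close> with \<open>1 \<le> i \<le> r \<le> l + 1\<close>, whose top row \<open>r = l + 1\<close> is the given \<open>p\<close> and whose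
  consecutive rows interlace. The value \<open>0\<close> outside the triangle only serves to make an array
  determined by its entries, so that each array is counted once in the sum below.\<close>

definition GT_arrays :: "nat \<Rightarrow> (nat \<Rightarrow> int) \<Rightarrow> (nat \<Rightarrow> nat \<Rightarrow> int) set" where
  "GT_arrays l p = {P.
     (\<forall>i\<in>{1..l+1}. P (l+1) i = p i) \<and>
     (\<forall>r\<in>{1..l}. \<forall>i\<in>{1..r}. P (r+1) i \<ge> P r i \<and> P r i \<ge> P (r+1) (i+1)) \<and>
     (\<forall>r i. \<not> (1 \<le> i \<and> i \<le> r \<and> r \<le> l+1) \<longrightarrow> P r i = 0)}"

definition q_Whittaker ::
  "complex \<Rightarrow> nat \<Rightarrow> (nat \<Rightarrow> complex) \<Rightarrow> (nat \<Rightarrow> int) \<Rightarrow> complex" where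
  "q_Whittaker q l z p =
     (if \<forall>i\<in>{1..l}. p i \<ge> p (i+1) then
        (\<Sum>P\<in>GT_arrays l p.
           (\<Prod>r=1..l+1. z r powi ((\<Sum>i=1..r. P r i) - (\<Sum>i=1..r-1. P (r-1) i))) *
           ((\<Prod>r=2..l. \<Prod>i=1..r-1. q_fact q (P r i - P r (i+1))) /
            (\<Prod>r=1..l. \<Prod>i=1..r. q_fact q (P (r+1) i - P r i) * q_fact q (P r i - P (r+1) (i+1)))))
      else 0)"

definition q_Whittaker_spec ::
  "complex \<Rightarrow> nat \<Rightarrow> (nat \<Rightarrow> complex) \<Rightarrow> int \<Rightarrow> int \<Rightarrow> complex" where
  "q_Whittaker_spec q l z n k = q_Whittaker q l z (\<lambda>i. if i = 1 then n + k else k)"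

section \<open>The functions entering the pairing\<close>

definition L_tilde :: "complex \<Rightarrow> nat \<Rightarrow> (nat \<Rightarrow> complex) \<Rightarrow> complex \<Rightarrow> complex" where
  "L_tilde q l z t = 1 / (\<Prod>j=1..l+1. \<Prod>m. 1 - t * z j * q ^ Suc m)"

definition I_fun ::
  "complex \<Rightarrow> nat \<Rightarrow> (nat \<Rightarrow> complex) \<Rightarrow> int \<Rightarrow> int \<Rightarrow> complex \<Rightarrow> complex" where
  "I_fun q l z n k t =
     (\<Prod>j=1..l+1. z j powi k) * t powi (- n) *
     (\<Sum>i. q powi (n * int i) * (1 / (\<Prod>j=1..l+1. \<Prod>m=1..i. 1 - t * z j * q powi (- int m))))"

section \<open>The pairing\<close>

text \<open>The integrands considered here have, besides the poles \<open>t = inverse (z j)\<close> that the contour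
  is to encircle, the possible singularities \<open>t = inverse (z j) * q powi m\<close> with \<open>m \<noteq> 0\<close> and their
  accumulation point \<open>t = 0\<close>; these must lie outside the contour. Such a contour exists iff no
  \<open>inverse (z i)\<close> is of the form \<open>inverse (z j) * q powi m\<close> with \<open>m \<noteq> 0\<close>, i.e. for generic
  equivariant parameters: see \<open>is_C0_nonresonant\<close> and \<open>ex_is_C0\<close> below.\<close>

definition is_C0 :: "complex \<Rightarrow> nat \<Rightarrow> (nat \<Rightarrow> complex) \<Rightarrow> (real \<Rightarrow> complex) \<Rightarrow> bool" where
  "is_C0 q l z \<gamma> \<longleftrightarrow>
     valid_path \<gamma> \<and> pathfinish \<gamma> = pathstart \<gamma> \<and>
     0 \<notin> path_image \<gamma> \<and> winding_number \<gamma> 0 = 0 \<and>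
     (\<forall>j\<in>{1..l+1}. \<forall>m::int.
        inverse (z j) * q powi m \<notin> path_image \<gamma> \<and>
        winding_number \<gamma> (inverse (z j) * q powi m) = (if m = 0 then 1 else 0))"

definition K_pairing ::
  "(real \<Rightarrow> complex) \<Rightarrow> nat \<Rightarrow> (nat \<Rightarrow> complex) \<Rightarrow> (complex \<Rightarrow> complex) \<Rightarrow> complex" where
  "K_pairing \<gamma> l z R =
     - (1 / (2 * of_real pi * \<i>)) *
       contour_integral \<gamma> (\<lambda>t. 1 / t * (R t / (\<Prod>j=1..l+1. 1 - t * z j)))"

lemma is_C0_nonresonant:
  assumes "is_C0 q l z \<gamma>" "i \<in> {1..l+1}" "j \<in> {1..l+1}" "m \<noteq> 0"
  shows "inverse (z i) \<noteq> inverse (z j) * q powi m"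
proof
  assume eq: "inverse (z i) = inverse (z j) * q powi m"
  have "winding_number \<gamma> (inverse (z i) * q powi 0) = 1"
    using assms(1,2) unfolding is_C0_def by presburger
  moreover have "winding_number \<gamma> (inverse (z j) * q powi m) = 0"
    using assms(1,3,4) unfolding is_C0_def by presburger
  ultimately show False
    using eq by simp
qed

lemma ex_contour_aux:
  fixes S A :: "complex set"
  assumes "open (- S)" "countable S" "finite A" "A \<subseteq> S" "b \<notin> S"
    and iso: "\<And>a. a \<in> A \<Longrightarrow> \<exists>e>0. S \<inter> cball a e = {a}"
  shows "\<exists>\<gamma>. valid_path \<gamma> \<and> pathstart \<gamma> = b \<and> pathfinish \<gamma> = b \<and> path_image \<gamma> \<inter> S = {} \<and>
     (\<forall>w\<in>S. winding_number \<gamma> w = (if w \<in> A then 1 else 0))"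
  using \<open>finite A\<close> \<open>A \<subseteq> S\<close> iso
proof (induction A rule: finite_induct)
  case empty
  have "winding_number (linepath b b) w = 0" if "w \<in> S" for w
    using that \<open>b \<notin> S\<close> unfolding linepath_refl by (intro winding_number_zero_const) auto
  then show ?case
    using \<open>b \<notin> S\<close> valid_path_linepath[of b b] pathstart_linepath[of b b] pathfinish_linepath[of b b]
      path_image_linepath[of b b]
    by (intro exI[of _ "linepath b b"]) (metis closed_segment_idem disjoint_iff empty_iff singletonD)
next
  case (insert a A)
  then obtain \<gamma> where \<gamma>: "valid_path \<gamma>" "pathstart \<gamma> = b" "pathfinish \<gamma> = b" "path_image \<gamma> \<inter> S = {}"
     "\<And>w. w \<in> S \<Longrightarrow> winding_number \<gamma> w = (if w \<in> A then 1 else 0)"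
    by auto
  obtain e where e: "e > 0" "S \<inter> cball a e = {a}"
    using insert.prems(2)[of a] by blast
  have "path_connected (UNIV - S)"
    using path_connected_complement_countable[of S] \<open>countable S\<close>
    by (simp add: Compl_eq_Diff_UNIV)
  then have "connected (- S)"
    by (simp add: Compl_eq_Diff_UNIV path_connected_imp_connected)
  have "a + of_real e \<in> cball a e" "a + of_real e \<noteq> a"
    using e(1) by (auto simp: dist_norm)
  then have "a + of_real e \<in> - S"
    using e(2) by blast
  then obtain g where g: "polynomial_function g" "path_image g \<subseteq> - S"
     "pathstart g = b" "pathfinish g = a + of_real e"
    using connected_open_polynomial_connected[OF \<open>open (- S)\<close> \<open>connected (- S)\<close>] \<open>b \<notin> S\<close>
    by (metis ComplI)
  have vg: "valid_path g"
    using g(1) valid_path_polynomial_function by blast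
  define c where "c = circlepath a e"
  have c: "valid_path c" "pathstart c = a + of_real e" "pathfinish c = a + of_real e"
    by (auto simp: c_def)
  have cim: "path_image c \<inter> S = {}"
  proof -
    have "path_image c \<subseteq> cball a e - {a}"
      using e(1) by (auto simp: c_def path_image_circlepath dist_commute)
    then show ?thesis using e(2) by blast
  qed
  have cw: "winding_number c w = (if w = a then 1 else 0)" if "w \<in> S" for w
  proof (cases "w = a")
    case True
    then show ?thesis
      using e(1) by (simp add: c_def winding_number_circlepath_centre)
  next
    case False
    then have "w \<notin> cball a e" using that e(2) by blast
    moreover have "path_image c \<subseteq> cball a e"
      using e(1) by (auto simp: c_def path_image_circlepath dist_commute)
    ultimately show ?thesis
      using False c by (simp add: winding_number_zero_outside[of c "cball a e"] valid_path_imp_path)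
  qed
  define h where "h = g +++ c +++ reversepath g +++ \<gamma>"
  have gS: "path_image g \<inter> S = {}" using g(2) by blast
  have "valid_path h" "pathstart h = b" "pathfinish h = b"
    using g vg c \<gamma> by (auto simp: h_def intro!: valid_path_join)
  moreover have "path_image h \<inter> S = {}"
    using gS cim \<gamma>(2-4) g(3,4) c(2,3) by (auto simp: h_def path_image_join)
  moreover have "winding_number h w = (if w \<in> insert a A then 1 else 0)" if "w \<in> S" for w
  proof -
    have w: "w \<notin> path_image g" "w \<notin> path_image c" "w \<notin> path_image \<gamma>"
      using that gS cim \<gamma>(4) by auto
    have p: "path g" "path c" "path \<gamma>"
      using vg c(1) \<gamma>(1) by (auto intro: valid_path_imp_path)
    have "winding_number h w =
        winding_number g w + (winding_number c w + (- winding_number g w + winding_number \<gamma> w))"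
      using w p g(3,4) c(2,3) \<gamma>(2,3)
      by (simp add: h_def winding_number_join winding_number_reversepath path_image_join)
    then show ?thesis
      using cw[OF that] \<gamma>(5)[OF that] \<open>a \<notin> A\<close> by auto
  qed
  ultimately show ?case by blast
qed

lemma finite_powi_between:
  fixes q :: complex
  assumes "q \<noteq> 0" "norm q < 1" "c > 0"
  shows "finite {m::int. c \<le> norm (q powi m) \<and> norm (q powi m) \<le> d}"
proof -
  define L where "L = ln (norm q)"
  have "L < 0" using assms by (simp add: L_def)
  have "{m::int. c \<le> norm (q powi m) \<and> norm (q powi m) \<le> d} \<subseteq> {\<lfloor>ln d / L\<rfloor>..\<lceil>ln c / L\<rceil>}"
  proof safe
    fix m :: int assume m: "c \<le> norm (q powi m)" "norm (q powi m) \<le> d"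
    have pos: "norm (q powi m) > 0" using assms by simp
    have "ln (norm (q powi m)) = of_int m * L"
      using assms by (simp add: norm_power_int L_def ln_powr flip: powr_real_of_int')
    moreover have "ln c \<le> ln (norm (q powi m))" "ln (norm (q powi m)) \<le> ln d"
      using m pos assms(3) by (auto intro!: ln_mono)
    ultimately have "ln c \<le> of_int m * L" "of_int m * L \<le> ln d" by auto
    then have "of_int m \<le> ln c / L" "ln d / L \<le> of_int m"
      using \<open>L < 0\<close> by (auto simp: field_simps)
    then show "m \<in> {\<lfloor>ln d / L\<rfloor>..\<lceil>ln c / L\<rceil>}"
      by (simp add: le_ceiling_iff floor_le_iff)
  qed
  then show ?thesis
    using finite_subset by blast
qed

lemma ex_is_C0:
  assumes q: "q \<noteq> 0" "norm q < 1" and z: "\<And>j. j \<in> {1..l+1} \<Longrightarrow> z j \<noteq> 0"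
    and nonres: "\<And>i j m. \<lbrakk>i \<in> {1..l+1}; j \<in> {1..l+1}; m \<noteq> 0\<rbrakk> \<Longrightarrow>
                   inverse (z i) \<noteq> inverse (z j) * q powi m"
  shows "\<exists>\<gamma>. is_C0 q l z \<gamma>"
proof -
  define S where "S = insert 0 (\<Union>j\<in>{1..l+1}. range (\<lambda>m::int. inverse (z j) * q powi m))"
  define A where "A = (\<lambda>j. inverse (z j)) ` {1..l+1}"
  have cS: "countable S" by (auto simp: S_def)
  have fin: "finite (S \<inter> cball x (norm x / 2))" if "x \<noteq> 0" for x
  proof -
    let ?M = "\<lambda>j. {m::int. norm x / 2 * norm (z j) \<le> norm (q powi m) \<and>
                        norm (q powi m) \<le> 3 * norm x / 2 * norm (z j)}"
    have "S \<inter> cball x (norm x / 2) \<subseteq>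
            (\<Union>j\<in>{1..l+1}. (\<lambda>m::int. inverse (z j) * q powi m) ` ?M j)"
    proof
      fix y assume y: "y \<in> S \<inter> cball x (norm x / 2)"
      then have "norm (x - y) \<le> norm x / 2" by (auto simp: dist_norm)
      then have b: "norm x / 2 \<le> norm y" "norm y \<le> 3 * norm x / 2"
        using norm_triangle_sub[of x y] norm_triangle_sub[of y x] by (auto simp: norm_minus_commute)
      then have "y \<noteq> 0" using that by auto
      then obtain j m where jm: "j \<in> {1..l+1}" "y = inverse (z j) * q powi m"
        using y by (auto simp: S_def)
      have "norm (q powi m) = norm y * norm (z j)"
        using jm z[OF jm(1)] by (simp add: norm_mult norm_inverse)
      then have "m \<in> ?M j"
        using mult_right_mono[OF b(1), of "norm (z j)"] mult_right_mono[OF b(2), of "norm (z j)"]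
        by simp
      then show "y \<in> (\<Union>j\<in>{1..l+1}. (\<lambda>m::int. inverse (z j) * q powi m) ` ?M j)"
        using jm by blast
    qed
    moreover have "finite (?M j)" if "j \<in> {1..l+1}" for j
      using z[OF that] \<open>x \<noteq> 0\<close> q by (intro finite_powi_between) auto
    ultimately show ?thesis
      by (meson finite_UN_I finite_atLeastAtMost finite_imageI finite_subset)
  qed
  have iso: "\<exists>e>0. S \<inter> cball x e \<subseteq> {x}" if "x \<noteq> 0" for x
  proof -
    have "finite (S \<inter> cball x (norm x / 2) - {x})"
      using fin[OF that] by auto
    then obtain d where d: "d > 0" "\<And>y. y \<in> S \<inter> cball x (norm x / 2) - {x} \<Longrightarrow> d \<le> dist x y"
      using finite_set_avoid[of "S \<inter> cball x (norm x / 2) - {x}" x] by auto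
    have "S \<inter> cball x (min (norm x / 2) (d / 2)) \<subseteq> {x}"
    proof
      fix y assume y: "y \<in> S \<inter> cball x (min (norm x / 2) (d / 2))"
      show "y \<in> {x}"
      proof (rule ccontr)
        assume "y \<notin> {x}"
        then have "d \<le> dist x y" using y by (intro d(2)) auto
        then show False using y d(1) by auto
      qed
    qed
    then show ?thesis
      using d(1) that by (intro exI[of _ "min (norm x / 2) (d / 2)"]) auto
  qed
  have oS: "open (- S)"
    unfolding open_contains_cball
  proof
    fix x assume x: "x \<in> - S"
    then have "x \<noteq> 0" by (auto simp: S_def)
    then obtain e where "e > 0" "S \<inter> cball x e \<subseteq> {x}" using iso by blast
    then show "\<exists>e>0. cball x e \<subseteq> - S" using x by blast
  qed
  have AS: "A \<subseteq> S"
  proof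
    fix y assume "y \<in> A"
    then obtain j where j: "j \<in> {1..l+1}" "y = inverse (z j) * q powi 0" by (auto simp: A_def)
    then show "y \<in> S" unfolding S_def by blast
  qed
  have A0: "0 \<notin> A" using z by (force simp: A_def)
  obtain b where b: "b \<notin> S"
    using cS uncountable_UNIV_complex by (metis UNIV_I countable_subset subsetI)
  have "\<exists>e>0. S \<inter> cball a e = {a}" if "a \<in> A" for a
  proof -
    have "a \<noteq> 0" "a \<in> S" using that A0 AS by auto
    then obtain e where "e > 0" "S \<inter> cball a e \<subseteq> {a}" using iso by blast
    moreover have "a \<in> cball a e" using \<open>e > 0\<close> by simp
    ultimately show ?thesis using \<open>a \<in> S\<close> by blast
  qed
  then obtain \<gamma> where \<gamma>: "valid_path \<gamma>" "pathstart \<gamma> = b" "pathfinish \<gamma> = b" "path_image \<gamma> \<inter> S = {}"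
     "\<And>w. w \<in> S \<Longrightarrow> winding_number \<gamma> w = (if w \<in> A then 1 else 0)"
    using ex_contour_aux[OF oS cS _ AS b] by (auto simp: A_def)
  have mem: "inverse (z j) * q powi m \<in> S" if "j \<in> {1..l+1}" for j m
    using that unfolding S_def by blast
  have "inverse (z j) * q powi m \<in> A \<longleftrightarrow> m = 0" if "j \<in> {1..l+1}" for j m
    using nonres[OF _ that, of _ m] that by (force simp: A_def)
  moreover have "0 \<in> S" by (simp add: S_def)
  ultimately have "is_C0 q l z \<gamma>"
    unfolding is_C0_def using \<gamma> mem A0 by auto
  then show ?thesis by blast
qed

end

theory Submission
  imports Defs
begin

text \<open>
  Both sides equal the product of the \<open>z j powi k\<close> and the coefficient of \<open>t ^ n\<close> in the inverse of
  \<open>qpoch_prod t = (\<Prod>j=1..l+1. qpoch q (t * z j))\<close>, where \<open>qpoch q x\<close> is the infinite product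
  of the \<open>1 - x * q ^ m\<close> over \<open>m \<ge> 0\<close>; this coefficient is \<open>0\<close> for \<open>n < 0\<close>.

  On the Whittaker side, the top row \<open>(n + k, k, \<dots>, k)\<close> forces all entries of an interlacing
  array outside the first column to be \<open>k\<close>. The array is then determined by the increments of its
  first column, which are \<open>l + 1\<close> natural numbers with sum \<open>n\<close>, and its weight is a product over
  these increments of a power of \<open>z j\<close> divided by a \<open>q\<close>-factorial (\<open>q_Whittaker_hook\<close>). By the
  \<open>q\<close>-binomial theorem (\<open>q_binomial_expansion\<close>), the sum of these weights is the coefficient in
  question.

  On the other side, multiplying \<open>qpoch_prod t\<close> by the product in the \<open>i\<close>-th term of \<open>I_fun\<close> gives
  \<open>qpoch_prod (t / q ^ i)\<close>. Hence the integrand is, up to the product of the \<open>z j powi k\<close>, the sum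
  over \<open>i\<close> of the pullbacks of the single differential \<open>kernel(s) ds\<close>,
  \<open>kernel s = s powi (- n - 1) / qpoch_prod s\<close>, along \<open>s = t / q ^ i\<close>. The contour picks up the
  residues at \<open>t = inverse (z j)\<close>; the \<open>i\<close>-th pullback contributes there the residue of \<open>kernel\<close> at
  \<open>inverse (z j) / q ^ i\<close>, so that altogether every pole of \<open>kernel\<close> except \<open>0\<close> is counted once
  (\<open>contour_integral_kernel_sum\<close>, \<open>residue_kernel_sum_sums\<close>). Since the integrals of \<open>kernel\<close> over
  suitable circles of growing radius tend to \<open>0\<close>, the sum of all residues of \<open>kernel\<close> vanishes
  (\<open>residue_kernel_0_plus_residues_kernel_sum\<close>). The pairing is thus the residue of \<open>kernel\<close> at \<open>0\<close>,
  which is the same coefficient (\<open>residue_kernel_0\<close>); the minus sign in the pairing cancels the one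
  from moving the residue at \<open>0\<close> to the other side.
\<close>

section \<open>The infinite \<open>q\<close>-Pochhammer symbol and the \<open>q\<close>-Gamma function\<close>

definition qpoch :: "complex \<Rightarrow> complex \<Rightarrow> complex" where
  "qpoch q x = (\<Prod>m. 1 - x * q ^ m)"

lemma convergent_prod_qpoch:
  fixes q x :: complex
  assumes "norm q < 1"
  shows "convergent_prod (\<lambda>m. 1 - x * q ^ m)"
proof -
  have "norm ((1 - x * q ^ m) - 1) = norm x * norm q ^ m" for m
    by (simp add: norm_mult norm_power)
  then have "summable (\<lambda>m. norm ((1 - x * q ^ m) - 1))"
    using assms by (simp only:) (intro summable_mult summable_geometric, simp)
  then show ?thesis
    by (intro abs_convergent_prod_imp_convergent_prod summable_imp_abs_convergent_prod)
qed

lemma qpoch_eq_0_iff: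
  assumes "norm q < 1"
  shows "qpoch q x = 0 \<longleftrightarrow> (\<exists>m. x * q ^ m = 1)"
proof -
  have "(\<lambda>m. 1 - x * q ^ m) has_prod qpoch q x"
    unfolding qpoch_def by (intro convergent_prod_has_prod convergent_prod_qpoch assms)
  then show ?thesis
    by (subst has_prod_eq_0_iff) auto
qed

text \<open>Splitting off the factor \<open>m = 0\<close>. This functional equation determines the power series
  of the inverse of \<open>qpoch\<close>, and it gives the ratio of two consecutive terms of the series that is
  integrated later.\<close>

lemma qpoch_rec:
  assumes "norm q < 1"
  shows "qpoch q x = (1 - x) * qpoch q (x * q)"
proof -
  have "(\<lambda>m. 1 - x * q ^ m) has_prod ((\<Prod>m<1. 1 - x * q ^ m) * (\<Prod>m. 1 - x * q ^ (m + 1)))"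
    by (intro has_prod_ignore_initial_segment' convergent_prod_qpoch assms)
  then have "qpoch q x = (\<Prod>m<1. 1 - x * q ^ m) * (\<Prod>m. 1 - x * q ^ (m + 1))"
    unfolding qpoch_def using has_prod_unique by metis
  then show ?thesis
    by (simp add: qpoch_def mult_ac)
qed

lemma holomorphic_qpoch:
  assumes "norm q < 1"
  shows "qpoch q holomorphic_on UNIV"
proof (rule holomorphic_uniform_sequence)
  show "(\<lambda>x. \<Prod>m<N. 1 - x * q ^ m) holomorphic_on UNIV" for N
    by (intro holomorphic_intros)
next
  fix x :: complex
  let ?P = "\<lambda>N x. \<Prod>m<N. 1 - x * q ^ m"
  have "uniformly_convergent_on (cball x 1) ?P"
  proof (rule uniformly_convergent_on_prod')
    show "uniformly_convergent_on (cball x 1) (\<lambda>N y. \<Sum>m<N. norm (1 - y * q ^ m - 1))"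
    proof (rule Weierstrass_m_test')
      fix m y assume "y \<in> cball x 1"
      then have "norm y \<le> norm x + 1"
        using norm_triangle_ineq2[of y x] by (auto simp: dist_norm norm_minus_commute)
      then show "norm (norm (1 - y * q ^ m - 1)) \<le> (norm x + 1) * norm q ^ m"
        by (simp add: norm_mult norm_power mult_right_mono)
    next
      show "summable (\<lambda>m. (norm x + 1) * norm q ^ m)"
        using assms by (intro summable_mult summable_geometric) auto
    qed
  qed (auto intro!: continuous_intros)
  then obtain g where g: "uniform_limit (cball x 1) ?P g sequentially"
    by (auto simp: uniformly_convergent_on_def)
  have "g y = qpoch q y" if "y \<in> cball x 1" for y
  proof (rule LIMSEQ_unique)
    show "(\<lambda>N. ?P N y) \<longlonglongrightarrow> g y"
      using tendsto_uniform_limitI[OF g that] .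
    show "(\<lambda>N. ?P N y) \<longlonglongrightarrow> qpoch q y"
      unfolding qpoch_def
      by (intro has_prod_imp_tendsto' convergent_prod_has_prod convergent_prod_qpoch assms)
  qed
  then have "uniform_limit (cball x 1) ?P (qpoch q) sequentially"
    using g by (subst uniform_limit_cong'[of _ _ ?P _ g]) auto
  then show "\<exists>d>0. cball x d \<subseteq> UNIV \<and> uniform_limit (cball x d) ?P (qpoch q) sequentially"
    by (intro exI[of _ 1]) auto
qed auto

lemma holomorphic_qpoch_compose [holomorphic_intros]:
  assumes "norm q < 1" "f holomorphic_on A"
  shows "(\<lambda>x. qpoch q (f x)) holomorphic_on A"
  using holomorphic_on_compose_gen[OF assms(2) holomorphic_qpoch[OF assms(1)]]
  by (simp add: o_def)

lemma q_fact_nz: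
  assumes "norm q < 1"
  shows "q_fact q m \<noteq> 0"
proof -
  have "1 - q ^ j \<noteq> 0" if "j \<in> {1..nat m}" for j
  proof
    assume "1 - q ^ j = 0"
    then have "norm q ^ j = 1"
      by (metis eq_iff_diff_eq_0 norm_one norm_power)
    then show False
      using assms that power_decreasing[of 1 j "norm q"] by simp
  qed
  then show ?thesis
    unfolding q_fact_def by (simp only: prod_zero_iff finite_atLeastAtMost) blast
qed

text \<open>Euler's case of the \<open>q\<close>-binomial theorem. Both sides of the functional equation of the
  inverse of \<open>qpoch q\<close> have a power series, and the resulting first-order recursion for the
  coefficients is that of the reciprocals of the \<open>q\<close>-factorials.\<close>

lemma q_binomial_expansion:
  assumes q: "norm q < 1"
  shows "(\<lambda>x. 1 / qpoch q x) has_fps_expansion Abs_fps (\<lambda>m. 1 / q_fact q (int m))"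
proof -
  have nz: "qpoch q x \<noteq> 0" if "x \<in> ball 0 1" for x
  proof
    assume "qpoch q x = 0"
    then obtain m where "x * q ^ m = 1" using qpoch_eq_0_iff[OF q] by blast
    then have "norm x * norm q ^ m = 1" by (metis norm_mult norm_one norm_power)
    moreover have "norm x * norm q ^ m \<le> norm x * 1"
      using q by (intro mult_left_mono power_le_one) auto
    ultimately show False using that by simp
  qed
  have holo: "(\<lambda>x. 1 / qpoch q x) holomorphic_on ball 0 1"
    using q nz by (intro holomorphic_intros) auto
  then have "(\<lambda>x. 1 / qpoch q x) analytic_on {0}"
    by (subst analytic_on_holomorphic) (auto intro!: exI[of _ "ball 0 1"])
  then obtain F where F: "(\<lambda>x. 1 / qpoch q x) has_fps_expansion F"
    using analytic_at_imp_has_fps_expansion_0 by blast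
  \<comment> \<open>Comparing coefficients in \<open>f (q x) = (1 - x) f x\<close> determines \<open>f\<close> up to its value at \<open>0\<close>.\<close>
  have lhs: "(\<lambda>x. 1 / qpoch q (q * x)) has_fps_expansion (F oo (fps_const q * fps_X))"
  proof -
    have "(\<lambda>x. q * x) has_fps_expansion fps_const q * fps_X"
      by (intro fps_expansion_intros)
    from has_fps_expansion_compose[OF F this] show ?thesis
      by (simp add: o_def)
  qed
  have rhs: "(\<lambda>x. (1 - x) * (1 / qpoch q x)) has_fps_expansion (1 - fps_X) * F"
    by (intro fps_expansion_intros F)
  have ev: "\<forall>\<^sub>F x in nhds 0. 1 / qpoch q (q * x) = (1 - x) * (1 / qpoch q x)"
  proof -
    have "eventually (\<lambda>x::complex. x \<in> ball 0 1) (nhds 0)"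
      by (intro eventually_nhds_in_open) auto
    then show ?thesis
    proof eventually_elim
      case (elim x)
      then show ?case
        using nz[OF elim] qpoch_rec[OF q, of x] by (auto simp: divide_simps mult_ac)
    qed
  qed
  have "(\<lambda>x. 1 / qpoch q (q * x)) has_fps_expansion (1 - fps_X) * F"
    using has_fps_expansion_cong[OF ev refl] rhs by blast
  from fps_expansion_unique_complex[OF lhs this]
  have "F oo (fps_const q * fps_X) = (1 - fps_X) * F" .
  then have coeff: "q ^ m * fps_nth F m = fps_nth ((1 - fps_X) * F) m" for m
    using fps_nth_compose_linear[of F q m] by simp
  have rec: "(1 - q ^ Suc m) * fps_nth F (Suc m) = fps_nth F m" for m
    using coeff[of "Suc m"] by (simp add: algebra_simps)
  have "qpoch q 0 = 1" by (simp add: qpoch_def)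
  then have F0: "fps_nth F 0 = 1"
    using has_fps_expansion_imp_0_eq_fps_nth_0[OF F] by simp
  have "fps_nth F m = 1 / q_fact q (int m)" for m
  proof (induction m)
    case 0
    then show ?case using F0 by (simp add: q_fact_def)
  next
    case (Suc m)
    have s: "q_fact q (int (Suc m)) = (1 - q ^ Suc m) * q_fact q (int m)"
      by (simp add: q_fact_def atLeastAtMostSuc_conv nat_add_distrib)
    then have "1 - q ^ Suc m \<noteq> 0" "q_fact q (int m) \<noteq> 0"
      using q_fact_nz[OF q] by auto
    then have "fps_nth F (Suc m) = fps_nth F m / (1 - q ^ Suc m)"
      using rec[of m] by (simp add: nonzero_eq_divide_eq mult.commute)
    then show ?case
      unfolding Suc s by simp
  qed
  then have "F = Abs_fps (\<lambda>m. 1 / q_fact q (int m))"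
    by (simp add: fps_eq_iff)
  then show ?thesis using F by simp
qed

text \<open>If \<open>x\<close> is a zero of \<open>qpoch q\<close>, both sides are \<open>0\<close>: one factor of the product on the left
  is \<open>1 / 0 = 0\<close>, and the product of the others still converges.\<close>

lemma q_Gamma_eq:
  assumes "norm q < 1"
  shows "q_Gamma q x = 1 / qpoch q x"
proof -
  have "q_Gamma q x = (\<Prod>m. inverse (1 - x * q ^ m))"
    unfolding q_Gamma_def by (simp add: divide_inverse mult.commute)
  also have "\<dots> = inverse (qpoch q x)"
    unfolding qpoch_def by (rule prodinf_inverse[OF convergent_prod_qpoch[OF assms]])
  finally show ?thesis by (simp add: divide_inverse)
qed

lemma L_tilde_eq: "L_tilde q l z t = 1 / (\<Prod>j=1..l+1. qpoch q (t * z j * q))"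
  unfolding L_tilde_def qpoch_def by (simp add: mult.assoc)

lemma L_tilde_eq_prod_q_Gamma:
  assumes "norm q < 1"
  shows "L_tilde q l z t = (\<Prod>j=1..l+1. q_Gamma q (q * t * z j))"
proof -
  have "q_Gamma q (q * t * z j) = 1 / qpoch q (t * z j * q)" for j
    using q_Gamma_eq[OF assms, of "q * t * z j"] by (simp add: mult_ac)
  then show ?thesis
    by (simp only: L_tilde_eq prod_dividef prod.neutral_const)
qed

section \<open>Residues under a homothety\<close>

text \<open>The residue belongs to the differential \<open>f(s) ds\<close> rather than to the function \<open>f\<close>, so
  the substitution \<open>s = t / c\<close> preserves it; the factor \<open>1 / c\<close> is \<open>ds / dt\<close>. The proof integrates
  over a small circle around \<open>a\<close> and over its image under the substitution.\<close>

lemma residue_rescale: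
  assumes "open U" "a / c \<in> U" "f holomorphic_on U - {a / c}" "c \<noteq> 0"
  shows "residue (\<lambda>t. f (t / c) / c) a = residue f (a / c)"
proof -
  obtain d where d: "d > 0" "ball (a / c) d \<subseteq> U"
    using assms(1,2) by (meson open_contains_ball)
  define r where "r = d * norm c / 2"
  have "0 < d * norm c" using d(1) assms(4) by simp
  then have r: "r > 0" "cball a r \<subseteq> ball a (d * norm c)"
    by (auto simp: r_def)
  have dist_scale: "dist (a / c) (t / c) = dist a t / norm c" for t
    by (simp add: dist_norm norm_divide flip: diff_divide_distrib)
  have hol: "(\<lambda>t. f (t / c) / c) holomorphic_on ball a (d * norm c) - {a}"
  proof -
    have "t / c \<in> U - {a / c}" if "t \<in> ball a (d * norm c) - {a}" for t
    proof -
      have "dist (a / c) (t / c) < d"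
        using that assms(4) unfolding dist_scale by (simp add: field_simps)
      then show ?thesis using d(2) that assms(4) by auto
    qed
    then have "(f \<circ> (\<lambda>t. t / c)) holomorphic_on ball a (d * norm c) - {a}"
      using assms(4)
      by (intro holomorphic_on_compose_gen[OF _ assms(3)] holomorphic_intros) auto
    then show ?thesis
      using assms(4) by (intro holomorphic_intros) (auto simp: o_def)
  qed
  have "((\<lambda>t. f (t / c) / c) has_contour_integral 2 * pi * \<i> * residue (\<lambda>t. f (t / c) / c) a) (circlepath a r)"
    using d(1) assms(4) by (intro base_residue[OF _ _ r(1) hol r(2)]) auto
  then have 1: "contour_integral (circlepath a r) (\<lambda>t. f (t / c) / c) = 2 * pi * \<i> * residue (\<lambda>t. f (t / c) / c) a"
    by (rule contour_integral_unique)
  define g where "g = (\<lambda>t. t / c) \<circ> circlepath a r"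
  have an: "(\<lambda>t. t / c) analytic_on UNIV" using assms(4) by (intro analytic_intros) auto
  have der: "deriv (\<lambda>t. t / c) t = 1 / c" for t
    by (rule DERIV_imp_deriv) (use assms(4) in \<open>auto intro!: derivative_eq_intros\<close>)
  have change: "contour_integral g h = contour_integral (circlepath a r) (\<lambda>w. h (w / c) / c)" for h
    unfolding g_def by (subst contour_integral_comp_analyticW[OF an]) (auto simp: der)
  have vg: "valid_path g"
    unfolding g_def using an by (intro valid_path_compose_analytic[of _ _ UNIV]) auto
  have loop: "pathfinish g = pathstart g"
    by (simp add: g_def pathfinish_compose pathstart_compose)
  have img: "path_image g = (\<lambda>t. t / c) ` sphere a r"
    using r(1) by (simp add: g_def path_image_compose)
  have sub: "path_image g \<subseteq> ball (a / c) d - {a / c}"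
  proof
    fix y assume "y \<in> path_image g"
    then obtain t where t: "y = t / c" "dist a t = r" unfolding img by force
    have "dist (a / c) y = d / 2"
      unfolding t(1) dist_scale t(2) using assms(4) by (simp add: r_def)
    then show "y \<in> ball (a / c) d - {a / c}" using d(1) by auto
  qed
  have wn: "winding_number g (a / c) = 1"
  proof -
    have "winding_number g (a / c) = 1 / (2 * pi * \<i>) * contour_integral g (\<lambda>w. 1 / (w - a / c))"
      using sub by (intro winding_number_valid_path[OF vg]) auto
    also have "contour_integral g (\<lambda>w. 1 / (w - a / c)) = contour_integral (circlepath a r) (\<lambda>w. 1 / (w - a))"
    proof -
      have "1 / (w / c - a / c) / c = 1 / (w - a)" for w
        using assms(4) by (simp flip: diff_divide_distrib)
      then show ?thesis by (simp add: change)
    qed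
    also have "\<dots> = 2 * pi * \<i>"
      using contour_integral_circlepath[OF r(1)] by simp
    finally show ?thesis by simp
  qed
  have "contour_integral g f = 2 * pi * \<i> * (\<Sum>p\<in>{a / c}. winding_number g p * residue f p)"
  proof (rule Residue_theorem[of "ball (a / c) d"])
    show "f holomorphic_on ball (a / c) d - {a / c}"
      using d(2) by (intro holomorphic_on_subset[OF assms(3)]) auto
    show "\<forall>w. w \<notin> ball (a / c) d \<longrightarrow> winding_number g w = 0"
      using sub loop vg
      by (intro allI impI winding_number_zero_outside[of g "ball (a / c) d"]) (auto intro: valid_path_imp_path)
  qed (use vg loop sub in auto)
  then show ?thesis
    using 1 by (simp add: wn change)
qed

section \<open>Orbits under multiplication by powers of \<open>q\<close>\<close>

text \<open>The orbits of finitely many points under multiplication by powers of \<open>q\<close>, together with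
  \<open>0\<close>, their only accumulation point in the plane. Every set that contains \<open>0\<close> and otherwise
  consists of points of these orbits is therefore closed, which makes its complement an admissible
  domain for the residue theorem even though it may omit infinitely many points.\<close>

locale q_lattice =
  fixes q :: complex and base_points :: "complex set"
  assumes q_nz: "q \<noteq> 0" and q_lt_1: "norm q < 1"
    and finite_base_points: "finite base_points" and zero_notin_base_points: "0 \<notin> base_points"
begin

definition q_orbits :: "complex set" where
  "q_orbits = insert 0 {a * q powi m |a m. a \<in> base_points}"

lemma in_q_orbits: "a \<in> base_points \<Longrightarrow> a * q powi m \<in> q_orbits"
  by (auto simp: q_orbits_def)

lemma base_points_subset_q_orbits: "base_points \<subseteq> q_orbits"
  using in_q_orbits[of _ 0] by auto

lemma countable_q_orbits: "countable q_orbits"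
proof -
  have "q_orbits = insert 0 (\<Union>a\<in>base_points. range (\<lambda>m. a * q powi m))" by (auto simp: q_orbits_def)
  moreover have "countable base_points" using finite_base_points by (rule countable_finite)
  ultimately show ?thesis by auto
qed

lemma finite_q_orbits_near:
  assumes "x \<noteq> 0"
  shows "finite (q_orbits \<inter> cball x (norm x / 2))"
proof -
  let ?M = "\<lambda>a. {m::int. norm x / 2 / norm a \<le> norm (q powi m) \<and>
                         norm (q powi m) \<le> 3 * norm x / 2 / norm a}"
  have "q_orbits \<inter> cball x (norm x / 2) \<subseteq> (\<Union>a\<in>base_points. (\<lambda>m. a * q powi m) ` ?M a)"
  proof
    fix y assume y: "y \<in> q_orbits \<inter> cball x (norm x / 2)"
    then have "norm (x - y) \<le> norm x / 2" by (auto simp: dist_norm)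
    then have b: "norm x / 2 \<le> norm y" "norm y \<le> 3 * norm x / 2"
      using norm_triangle_sub[of x y] norm_triangle_sub[of y x] by (auto simp: norm_minus_commute)
    then have "y \<noteq> 0" using assms by auto
    then obtain a m where am: "a \<in> base_points" "y = a * q powi m"
      using y by (auto simp: q_orbits_def)
    have "norm a > 0" using am(1) zero_notin_base_points by auto
    moreover have "norm y = norm a * norm (q powi m)"
      using am(2) by (simp add: norm_mult)
    ultimately have "m \<in> ?M a"
      using b by (simp add: field_simps)
    then show "y \<in> (\<Union>a\<in>base_points. (\<lambda>m. a * q powi m) ` ?M a)"
      using am by blast
  qed
  moreover have "finite (?M a)" if "a \<in> base_points" for a
  proof -
    have "a \<noteq> 0" using that zero_notin_base_points by auto
    then show ?thesis using assms q_nz q_lt_1 by (intro finite_powi_between) auto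
  qed
  ultimately show ?thesis
    using finite_base_points by (meson finite_UN_I finite_imageI finite_subset)
qed

lemma q_orbits_discrete:
  assumes "x \<noteq> 0"
  obtains e where "e > 0" "q_orbits \<inter> cball x e \<subseteq> {x}"
proof -
  have "finite (q_orbits \<inter> cball x (norm x / 2) - {x})"
    using finite_q_orbits_near[OF assms] by auto
  then obtain d where d: "d > 0" "\<And>y. y \<in> q_orbits \<inter> cball x (norm x / 2) - {x} \<Longrightarrow> y \<noteq> x \<Longrightarrow> d \<le> dist x y"
    using finite_set_avoid[of "q_orbits \<inter> cball x (norm x / 2) - {x}" x] by auto
  show thesis
  proof
    show "min (norm x / 2) (d / 2) > 0" using d assms by auto
    show "q_orbits \<inter> cball x (min (norm x / 2) (d / 2)) \<subseteq> {x}"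
    proof
      fix y assume y: "y \<in> q_orbits \<inter> cball x (min (norm x / 2) (d / 2))"
      show "y \<in> {x}"
      proof (rule ccontr)
        assume "y \<notin> {x}"
        then have "d \<le> dist x y" using y by (intro d(2)) auto
        then show False using y d(1) by auto
      qed
    qed
  qed
qed

lemma open_Compl_subset_q_orbits:
  assumes "T \<subseteq> q_orbits" "0 \<in> T"
  shows "open (- T)"
  unfolding open_contains_cball
proof
  fix x assume x: "x \<in> - T"
  then have "x \<noteq> 0" using assms(2) by auto
  then obtain e where "e > 0" "q_orbits \<inter> cball x e \<subseteq> {x}" by (rule q_orbits_discrete)
  then show "\<exists>e>0. cball x e \<subseteq> - T" using x assms(1) by blast
qed

lemma zero_in_q_orbits: "0 \<in> q_orbits"
  by (simp add: q_orbits_def)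

lemma open_Compl_q_orbits: "open (- q_orbits)"
  by (rule open_Compl_subset_q_orbits) (auto simp: zero_in_q_orbits)

end

section \<open>The integrand as a sum of pullbacks\<close>

text \<open>The denominator of the integrand is the product \<open>qpoch_prod\<close>, up to a monomial the
  integrand is the sum \<open>kernel_sum\<close> of the functions \<open>shifted_kernel i\<close>, and these are the pullbacks
  of the one differential \<open>kernel(s) ds\<close> along the substitutions \<open>s = t / q ^ i\<close>. This is why the
  factor \<open>1 / q ^ i\<close> is included in \<open>shifted_kernel i\<close>, and why \<open>kernel\<close> has the exponent \<open>- n - 1\<close>:
  it absorbs the \<open>1 / t\<close> of the measure \<open>dt / t\<close>.\<close>

locale q_kernel =
  fixes q :: complex and l :: nat and z :: "nat \<Rightarrow> complex" and n :: int
  assumes q_nz': "q \<noteq> 0" and q_lt_1': "norm q < 1"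
    and z_nz: "\<And>j. j \<in> {1..l+1} \<Longrightarrow> z j \<noteq> 0"
begin

definition base_points :: "complex set" where
  "base_points = (\<lambda>j. inverse (z j)) ` {1..l+1}"

sublocale q_lattice q base_points
  by unfold_locales (use q_nz' q_lt_1' z_nz in \<open>auto simp: base_points_def\<close>)

definition qpoch_prod :: "complex \<Rightarrow> complex" where
  "qpoch_prod s = (\<Prod>j=1..l+1. qpoch q (s * z j))"

definition kernel :: "complex \<Rightarrow> complex" where
  "kernel s = s powi (- n - 1) / qpoch_prod s"

definition shifted_kernel :: "nat \<Rightarrow> complex \<Rightarrow> complex" where
  "shifted_kernel i t = kernel (t / q ^ i) / q ^ i"

definition kernel_sum :: "complex \<Rightarrow> complex" where
  "kernel_sum t = (\<Sum>i. shifted_kernel i t)"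

lemma qpoch_prod_0: "qpoch_prod 0 = 1"
  by (simp add: qpoch_prod_def qpoch_def)

lemma qpoch_prod_eq_0_iff: "qpoch_prod s = 0 \<longleftrightarrow> (\<exists>a\<in>base_points. \<exists>m. s = a / q ^ m)"
proof -
  have "s * z j * q ^ m = 1 \<longleftrightarrow> s = inverse (z j) / q ^ m" if "j \<in> {1..l+1}" for j m
    using z_nz[OF that] q_nz by (auto simp: field_simps)
  moreover have "qpoch_prod s = 0 \<longleftrightarrow> (\<exists>j\<in>{1..l+1}. \<exists>m. s * z j * q ^ m = 1)"
    unfolding qpoch_prod_def by (simp only: prod_zero_iff[OF finite_atLeastAtMost] qpoch_eq_0_iff[OF q_lt_1])
  ultimately show ?thesis
    unfolding base_points_def by blast
qed

lemma holomorphic_qpoch_prod: "qpoch_prod holomorphic_on U"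
  unfolding qpoch_prod_def[abs_def] using q_lt_1 by (intro holomorphic_intros)

lemma open_qpoch_prod_nz: "open {s. qpoch_prod s \<noteq> 0}"
  using holomorphic_on_imp_continuous_on[OF holomorphic_qpoch_prod]
  by (intro open_Collect_neq continuous_intros) auto

lemma qpoch_prod_rec: "qpoch_prod (s / q) = (\<Prod>j=1..l+1. 1 - s / q * z j) * qpoch_prod s"
proof -
  have "qpoch q (s / q * z j) = (1 - s / q * z j) * qpoch q (s * z j)" for j
    using qpoch_rec[OF q_lt_1, of "s / q * z j"] q_nz by simp
  then show ?thesis
    unfolding qpoch_prod_def by (simp only: prod.distrib)
qed

lemma holomorphic_kernel:
  assumes "0 \<notin> U" "\<And>a m. a \<in> base_points \<Longrightarrow> a / q ^ m \<notin> U"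
  shows "kernel holomorphic_on U"
proof -
  have "qpoch_prod s \<noteq> 0" if "s \<in> U" for s
    using that assms(2) by (auto simp: qpoch_prod_eq_0_iff)
  moreover have "\<forall>s\<in>U. s \<noteq> 0"
    using assms(1) by auto
  ultimately show ?thesis
    unfolding kernel_def[abs_def] by (intro holomorphic_intros holomorphic_qpoch_prod disjI2)
qed

lemma holomorphic_shifted_kernel:
  assumes "0 \<notin> U" "\<And>a m. a \<in> base_points \<Longrightarrow> a * q ^ i / q ^ m \<notin> U"
  shows "shifted_kernel i holomorphic_on U"
proof -
  have "kernel holomorphic_on ((\<lambda>t. t / q ^ i) ` U)"
  proof (rule holomorphic_kernel)
    fix a m assume "a \<in> base_points"
    show "a / q ^ m \<notin> (\<lambda>t. t / q ^ i) ` U"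
    proof
      assume "a / q ^ m \<in> (\<lambda>t. t / q ^ i) ` U"
      then obtain t where "t \<in> U" "a / q ^ m = t / q ^ i" by blast
      then have "a * q ^ i / q ^ m \<in> U" using q_nz by (simp add: field_simps)
      then show False using assms(2) \<open>a \<in> base_points\<close> by blast
    qed
  qed (use assms(1) q_nz in auto)
  then have "(kernel \<circ> (\<lambda>t. t / q ^ i)) holomorphic_on U"
    using q_nz by (intro holomorphic_on_compose holomorphic_intros) auto
  then show ?thesis
    unfolding shifted_kernel_def[abs_def] using q_nz by (intro holomorphic_intros) (auto simp: o_def)
qed

lemma pole_in_q_orbits: "a \<in> base_points \<Longrightarrow> a * q ^ i / q ^ m \<in> q_orbits"
  using in_q_orbits[of a "int i - int m"] q_nz by (simp add: power_int_diff)

lemma holomorphic_shifted_kernel_Compl_q_orbits: "U \<subseteq> - q_orbits \<Longrightarrow> shifted_kernel i holomorphic_on U"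
  using pole_in_q_orbits zero_in_q_orbits by (intro holomorphic_shifted_kernel) blast+

text \<open>The functional equation of \<open>qpoch\<close> turns the step from \<open>i\<close> to \<open>i + 1\<close> into \<open>l + 1\<close>
  explicit factors.\<close>

lemma shifted_kernel_Suc:
  assumes "t \<noteq> 0"
  shows "shifted_kernel (Suc i) t = shifted_kernel i t * q powi n * (1 / (\<Prod>j=1..l+1. 1 - t * z j / q ^ Suc i))"
proof -
  define s where "s = t / q ^ i"
  have s: "s \<noteq> 0" "t / q ^ Suc i = s / q" using assms q_nz by (auto simp: s_def)
  have "shifted_kernel (Suc i) t = (s / q) powi (- n - 1) / qpoch_prod (s / q) / q ^ Suc i"
    unfolding shifted_kernel_def kernel_def s(2) ..
  also have "\<dots> = s powi (- n - 1) / q powi (- n - 1) / ((\<Prod>j=1..l+1. 1 - s / q * z j) * qpoch_prod s) / (q * q ^ i)"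
    by (simp only: power_int_divide_distrib qpoch_prod_rec power_Suc)
  also have "\<dots> = s powi (- n - 1) / qpoch_prod s / q ^ i * (1 / (q powi (- n - 1) * q)) * (1 / (\<Prod>j=1..l+1. 1 - s / q * z j))"
    by simp
  also have "1 / (q powi (- n - 1) * q) = q powi n"
    using q_nz by (simp add: power_int_diff power_int_minus field_simps)
  also have "s / q = t / q ^ Suc i" using s by simp
  finally show ?thesis by (simp add: shifted_kernel_def kernel_def s_def)
qed

text \<open>By the preceding lemma the ratio of consecutive terms is \<open>q powi n\<close> divided by a product
  whose factors grow like \<open>1 / norm q ^ i\<close>, uniformly as long as \<open>t\<close> stays away from \<open>0\<close>. Hence the
  ratio is eventually below \<open>1/2\<close>, whatever the sign of \<open>n\<close>.\<close>

lemma shifted_kernel_bound: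
  assumes "compact T" "T \<subseteq> - q_orbits"
  obtains i0 B where "\<And>d t. t \<in> T \<Longrightarrow> norm (shifted_kernel (i0 + d) t) \<le> B * (1/2) ^ d"
proof -
  have "compact T" "0 \<notin> T" using assms zero_in_q_orbits by auto
  then obtain \<delta> where \<delta>: "\<delta> > 0" "\<And>t. t \<in> T \<Longrightarrow> \<delta> \<le> norm t"
    using separate_point_closed[of T 0] compact_imp_closed by auto
  \<comment> \<open>If all factors are at least \<open>X\<close>, so is their product because \<open>X \<ge> 1\<close>; then \<open>X \<ge> 2 |q^n|\<close> gives the ratio.\<close>
  define X where "X = max 1 (2 * norm (q powi n))"
  have "\<exists>i0. \<forall>i\<ge>i0. X + 1 \<le> \<delta> * norm (z j) / norm q ^ Suc i" if "j \<in> {1..l+1}" for j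
  proof -
    have "filterlim (\<lambda>i. inverse (norm q ^ i)) at_top sequentially"
      using q_lt_1 q_nz
      by (intro filterlim_inverse_at_top LIMSEQ_power_zero) (auto intro!: always_eventually)
    then have "filterlim (\<lambda>i. (\<delta> * norm (z j)) * inverse (norm q ^ Suc i)) at_top sequentially"
      using \<delta>(1) z_nz[OF that]
      by (intro filterlim_tendsto_pos_mult_at_top[OF tendsto_const] filterlim_compose[OF _ filterlim_Suc]) auto
    then have "eventually (\<lambda>i. X + 1 \<le> (\<delta> * norm (z j)) * inverse (norm q ^ Suc i)) sequentially"
      by (simp add: filterlim_at_top)
    then show ?thesis by (simp add: eventually_sequentially divide_inverse)
  qed
  then obtain I where I: "\<And>j i. j \<in> {1..l+1} \<Longrightarrow> i \<ge> I j \<Longrightarrow> X + 1 \<le> \<delta> * norm (z j) / norm q ^ Suc i"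
    by metis
  define i0 where "i0 = Max (I ` {1..l+1})"
  have step: "norm (shifted_kernel (Suc i) t) \<le> norm (shifted_kernel i t) / 2" if "i \<ge> i0" "t \<in> T" for i t
  proof -
    have fac: "X \<le> norm (1 - t * z j / q ^ Suc i)" if "j \<in> {1..l+1}" for j
    proof -
      have "I j \<le> i" using \<open>i \<ge> i0\<close> that Max_ge[of "I ` {1..l+1}" "I j"] unfolding i0_def by auto
      then have "X + 1 \<le> \<delta> * norm (z j) / norm q ^ Suc i" using I that by blast
      also have "\<dots> \<le> norm t * norm (z j) / norm q ^ Suc i"
        using \<delta>(2)[OF \<open>t \<in> T\<close>] by (intro divide_right_mono mult_right_mono) auto
      also have "\<dots> = norm (t * z j / q ^ Suc i)"
        by (simp add: norm_mult norm_divide norm_power)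
      finally show ?thesis
        using norm_triangle_ineq2[of "t * z j / q ^ Suc i" 1] by (simp add: norm_minus_commute)
    qed
    have X1: "1 \<le> X" by (simp add: X_def)
    define P where "P = (\<Prod>j=1..l+1. 1 - t * z j / q ^ Suc i)"
    have "X \<le> X ^ (l + 1)" using X1 self_le_power[of X "l + 1"] by simp
    also have "\<dots> = (\<Prod>j=1..l+1. X)" by simp
    also have "\<dots> \<le> (\<Prod>j=1..l+1. norm (1 - t * z j / q ^ Suc i))"
      using X1 fac by (intro prod_mono) auto
    also have "(\<Prod>j=1..l+1. norm (1 - t * z j / q ^ Suc i)) = norm P"
      unfolding P_def by (simp only: prod_norm)
    finally have P: "X \<le> norm P" .
    have "norm (q powi n) / norm P \<le> 1 / 2"
    proof -
      have "2 * norm (q powi n) \<le> norm P" "norm P > 0" using P X1 by (auto simp: X_def)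
      then show ?thesis by (simp add: field_simps)
    qed
    have "t \<noteq> 0" using \<open>0 \<notin> T\<close> that by auto
    then have "norm (shifted_kernel (Suc i) t) = norm (shifted_kernel i t) * (norm (q powi n) / norm P)"
      unfolding shifted_kernel_Suc[OF \<open>t \<noteq> 0\<close>] P_def[symmetric] by (simp add: norm_mult norm_divide)
    also have "\<dots> \<le> norm (shifted_kernel i t) * (1 / 2)"
      by (intro mult_left_mono) (fact, simp)
    finally show ?thesis by simp
  qed
  have "continuous_on T (shifted_kernel i0)"
    using holomorphic_shifted_kernel_Compl_q_orbits[OF assms(2)] by (rule holomorphic_on_imp_continuous_on)
  then have "bounded (shifted_kernel i0 ` T)"
    using assms(1) compact_continuous_image compact_imp_bounded by blast
  then obtain B where B: "\<And>t. t \<in> T \<Longrightarrow> norm (shifted_kernel i0 t) \<le> B"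
    by (auto simp: bounded_iff)
  have "norm (shifted_kernel (i0 + d) t) \<le> B * (1/2) ^ d" if "t \<in> T" for d t
  proof (induction d)
    case 0
    then show ?case using B that by simp
  next
    case (Suc d)
    have "norm (shifted_kernel (i0 + Suc d) t) \<le> norm (shifted_kernel (i0 + d) t) / 2"
      using step[of "i0 + d" t] that by simp
    then show ?case using Suc by simp
  qed
  then show thesis by (rule that)
qed

lemma uniform_limit_kernel_sum:
  assumes "compact T" "T \<subseteq> - q_orbits"
  shows "uniform_limit T (\<lambda>N t. \<Sum>i<N. shifted_kernel i t) kernel_sum sequentially"
proof -
  obtain i0 B where B: "\<And>d t. t \<in> T \<Longrightarrow> norm (shifted_kernel (i0 + d) t) \<le> B * (1/2) ^ d"
    using shifted_kernel_bound[OF assms] by blast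
  have "eventually (\<lambda>i. \<forall>t\<in>T. norm (shifted_kernel i t) \<le> B * 2 ^ i0 * (1/2) ^ i) sequentially"
    using eventually_ge_at_top[of i0]
  proof eventually_elim
    case (elim i)
    then have "i = i0 + (i - i0)" by simp
    moreover have "(2::real) ^ i0 * (1/2) ^ (i0 + (i - i0)) = (1/2) ^ (i - i0)"
      by (simp only: power_add) (simp add: power_one_over)
    ultimately show ?case using B[of _ "i - i0"] by (metis mult.assoc)
  qed
  moreover have "summable (\<lambda>i. B * 2 ^ i0 * (1/2) ^ i)"
    by (intro summable_mult summable_geometric) auto
  ultimately show ?thesis
    unfolding kernel_sum_def[abs_def] by (rule Weierstrass_m_test_ev)
qed

lemma shifted_kernel_sums_kernel_sum:
  assumes "t \<notin> q_orbits"
  shows "(\<lambda>i. shifted_kernel i t) sums kernel_sum t"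
  using tendsto_uniform_limitI[OF uniform_limit_kernel_sum[of "{t}"], of t] assms by (simp add: sums_def)

lemma holomorphic_kernel_sum: "kernel_sum holomorphic_on - q_orbits"
proof (rule holomorphic_uniform_sequence[OF open_Compl_q_orbits])
  show "(\<lambda>t. \<Sum>i<N. shifted_kernel i t) holomorphic_on - q_orbits" for N
    by (intro holomorphic_intros holomorphic_shifted_kernel_Compl_q_orbits order_refl)
next
  fix x assume "x \<in> - q_orbits"
  then obtain d where "d > 0" "cball x d \<subseteq> - q_orbits"
    using open_Compl_q_orbits open_contains_cball by blast
  then show "\<exists>d>0. cball x d \<subseteq> - q_orbits \<and> uniform_limit (cball x d) (\<lambda>N t. \<Sum>i<N. shifted_kernel i t) kernel_sum sequentially"
    using uniform_limit_kernel_sum[of "cball x d"] by auto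
qed

text \<open>Used twice: on small circles around the points of \<open>base_points\<close> it turns the residues of
  \<open>kernel_sum\<close> into series of residues of \<open>kernel\<close>, and on a circle around \<open>0\<close> it shows that the
  integrals of \<open>shifted_kernel i\<close> tend to \<open>0\<close>.\<close>

lemma circle_integral_sums:
  assumes "r > 0" "sphere c r \<subseteq> - q_orbits"
  shows "(\<lambda>i. contour_integral (circlepath c r) (shifted_kernel i)) sums contour_integral (circlepath c r) kernel_sum"
proof -
  have int: "shifted_kernel i contour_integrable_on circlepath c r" for i
    using assms
    by (intro contour_integrable_holomorphic_simple[OF _ open_Compl_q_orbits] holomorphic_shifted_kernel_Compl_q_orbits) auto
  then have "(\<lambda>t. \<Sum>i<N. shifted_kernel i t) contour_integrable_on circlepath c r" for N
    by (intro contour_integrable_sum) auto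
  then have "(\<lambda>N. contour_integral (circlepath c r) (\<lambda>t. \<Sum>i<N. shifted_kernel i t))
      \<longlonglongrightarrow> contour_integral (circlepath c r) kernel_sum"
    using assms by (intro contour_integral_uniform_limit_circlepath uniform_limit_kernel_sum) auto
  then show ?thesis
    using int by (simp add: sums_def contour_integral_sum)
qed

end

section \<open>The sum of all residues\<close>

lemma finite_geometric_gt:
  fixes x :: real
  assumes "0 < c" "0 < x" "x < 1"
  shows "finite {m. c < r * x ^ m}"
proof -
  have "(\<lambda>m. r * x ^ m) \<longlonglongrightarrow> r * 0"
    using assms by (intro tendsto_intros LIMSEQ_power_zero) auto
  then have "eventually (\<lambda>m. r * x ^ m < c) sequentially"
    using assms(1) by (intro order_tendstoD) auto
  then obtain M where "\<And>m. m \<ge> M \<Longrightarrow> r * x ^ m < c"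
    by (auto simp: eventually_sequentially)
  then have "{m. c < r * x ^ m} \<subseteq> {..<M}"
    by (force simp: not_less[symmetric])
  then show ?thesis by (rule finite_subset) simp
qed

text \<open>The index sets are initial segments of the natural numbers, and they exhaust them
  because the left side of the inequality that describes them tends to \<open>0\<close> as \<open>i\<close> grows.\<close>

lemma sum_geometric_threshold:
  fixes x :: real and u :: "nat \<Rightarrow> complex"
  assumes "0 < c" "0 < r" "0 < x" "x < 1" "u sums U"
  shows "(\<lambda>i. \<Sum>m | c * x ^ i < r * x ^ m. u m) \<longlonglongrightarrow> U"
proof -
  define N where "N i = card {m. c * x ^ i < r * x ^ m}" for i
  have fin: "finite {m. c * x ^ i < r * x ^ m}" for i
    using assms by (intro finite_geometric_gt) auto
  have down: "c * x ^ i < r * x ^ m'" if "c * x ^ i < r * x ^ m" "m' \<le> m" for i m m'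
  proof -
    have "r * x ^ m \<le> r * x ^ m'"
      using assms that(2) by (intro mult_left_mono power_decreasing) auto
    then show ?thesis using that(1) by simp
  qed
  have set_eq: "{m. c * x ^ i < r * x ^ m} = {..<N i}" for i
  proof -
    obtain k where "{m. c * x ^ i < r * x ^ m} = {..<k}"
    proof (cases "{m. c * x ^ i < r * x ^ m} = {}")
      case True
      then show ?thesis using that[of 0] by simp
    next
      case False
      define k where "k = Max {m. c * x ^ i < r * x ^ m}"
      have k: "c * x ^ i < r * x ^ k" using Max_in[OF fin False] by (simp add: k_def)
      have "c * x ^ i < r * x ^ m \<longleftrightarrow> m < Suc k" for m
        using down[OF k, of m] Max_ge[OF fin, of m i] by (auto simp: k_def less_Suc_eq_le)
      then have "{m. c * x ^ i < r * x ^ m} = {..<Suc k}" by auto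
      then show ?thesis by (rule that)
    qed
    then show ?thesis by (simp add: N_def)
  qed
  have "filterlim N at_top sequentially"
    unfolding filterlim_at_top
  proof
    fix Z
    have "(\<lambda>i. c * x ^ i) \<longlonglongrightarrow> c * 0"
      using assms by (intro tendsto_intros LIMSEQ_power_zero) auto
    then have "eventually (\<lambda>i. c * x ^ i < r * x ^ Z) sequentially"
      using assms(2,3) by (intro order_tendstoD(2)[of _ "c * 0"]) auto
    then show "eventually (\<lambda>i. Z \<le> N i) sequentially"
    proof eventually_elim
      case (elim i)
      then have "Z \<in> {..<N i}" unfolding set_eq[symmetric] by simp
      then show ?case by simp
    qed
  qed
  then show ?thesis
    unfolding set_eq using assms(5) unfolding sums_def by (intro filterlim_compose[of "\<lambda>N. \<Sum>m<N. u m" _ _ N])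
qed

context q_kernel
begin

lemma residue_shifted_kernel_0: "residue (shifted_kernel i) 0 = residue kernel 0"
proof -
  define U where "U = {s. qpoch_prod s \<noteq> 0}"
  have "open U"
    unfolding U_def by (rule open_qpoch_prod_nz)
  moreover have "0 \<in> U" by (simp add: U_def qpoch_prod_0)
  moreover have "kernel holomorphic_on U - {0}"
    by (intro holomorphic_kernel) (auto simp: U_def qpoch_prod_eq_0_iff)
  ultimately show ?thesis
    using residue_rescale[of U 0 "q ^ i" kernel] q_nz by (simp add: shifted_kernel_def[abs_def])
qed

lemma residue_shifted_kernel:
  assumes "x / q ^ i \<in> q_orbits" "x \<noteq> 0"
  shows "residue (shifted_kernel i) x = residue kernel (x / q ^ i)"
proof -
  define y where "y = x / q ^ i"
  have y: "y \<in> q_orbits" "y \<noteq> 0" using assms q_nz by (auto simp: y_def)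
  have "open (- (q_orbits - {y}))"
    using y zero_in_q_orbits by (intro open_Compl_subset_q_orbits) auto
  moreover have "kernel holomorphic_on - (q_orbits - {y}) - {y}"
  proof (rule holomorphic_kernel)
    fix a m assume "a \<in> base_points"
    then have "a / q ^ m \<in> q_orbits" using pole_in_q_orbits[of a 0 m] by simp
    then show "a / q ^ m \<notin> - (q_orbits - {y}) - {y}" by blast
  qed (use zero_in_q_orbits y in auto)
  ultimately show ?thesis
    using residue_rescale[of "- (q_orbits - {y})" x "q ^ i" kernel] q_nz y by (simp add: shifted_kernel_def[abs_def] y_def)
qed

text \<open>Near \<open>a\<close> the function \<open>kernel_sum\<close> is the sum of the \<open>shifted_kernel m\<close>, and
  \<open>shifted_kernel m\<close> carries the residue of \<open>kernel\<close> at \<open>a / q ^ m\<close> to \<open>a\<close>.\<close>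

lemma residue_kernel_sum_sums:
  assumes "a \<in> base_points"
  shows "(\<lambda>m. residue kernel (a / q ^ m)) sums residue kernel_sum a"
proof -
  have a: "a \<noteq> 0" "a \<in> q_orbits" using assms zero_notin_base_points base_points_subset_q_orbits by auto
  obtain e where e: "e > 0" "q_orbits \<inter> cball a e \<subseteq> {a}" using q_orbits_discrete[OF a(1)] by blast
  define U where "U = - (q_orbits - {a})"
  have "open U" unfolding U_def using a zero_in_q_orbits by (intro open_Compl_subset_q_orbits) auto
  moreover have "a \<in> U" "cball a e \<subseteq> U" "U - {a} = - q_orbits"
    using a e(2) by (auto simp: U_def)
  ultimately have U: "open U" "a \<in> U" "cball a e \<subseteq> U" "U - {a} = - q_orbits" by auto
  have sphere: "sphere a e \<subseteq> - q_orbits" using e by force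
  have int: "contour_integral (circlepath a e) f = 2 * pi * \<i> * residue f a"
    if "f holomorphic_on - q_orbits" for f
    using that U by (intro contour_integral_unique base_residue[OF U(1,2) e(1) _ U(3)]) simp
  have "(\<lambda>i. contour_integral (circlepath a e) (shifted_kernel i)) sums contour_integral (circlepath a e) kernel_sum"
    using e(1) sphere by (rule circle_integral_sums)
  then have "(\<lambda>i. 2 * pi * \<i> * residue (shifted_kernel i) a) sums (2 * pi * \<i> * residue kernel_sum a)"
    by (simp only: int[OF holomorphic_kernel_sum] int[OF holomorphic_shifted_kernel_Compl_q_orbits[OF order_refl]])
  then have "(\<lambda>i. residue (shifted_kernel i) a) sums residue kernel_sum a"
    by (subst (asm) sums_mult_iff) auto
  moreover have "residue (shifted_kernel i) a = residue kernel (a / q ^ i)" for i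
    using pole_in_q_orbits[OF assms, of 0 i] a by (intro residue_shifted_kernel) auto
  ultimately show ?thesis by simp
qed

end

text \<open>Nonresonance keeps the poles \<open>a / q ^ m\<close> of \<open>kernel\<close> apart for different pairs \<open>(a, m)\<close>.
  Several \<open>j\<close> may have the same \<open>z j\<close>, which makes poles of higher order; the set \<open>base_points\<close>
  lists their positions once.\<close>

locale q_kernel_nonresonant = q_kernel +
  assumes nonresonant: "\<And>a b m. a \<in> base_points \<Longrightarrow> b \<in> base_points \<Longrightarrow> m \<noteq> 0 \<Longrightarrow> a \<noteq> b * q powi m"
begin

lemma poles_distinct:
  assumes "a \<in> base_points" "b \<in> base_points" "a * q ^ i / q ^ m = b * q ^ i / q ^ m'"
  shows "a = b \<and> m = m'"
proof -
  have "a = b * q powi (int m - int m')"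
    using assms(3) q_nz by (simp add: power_int_diff field_simps)
  then show ?thesis
    using nonresonant[OF assms(1,2), of "int m - int m'"] by fastforce
qed

text \<open>Pulled back to \<open>kernel\<close>, this is the integral over the circle of radius
  \<open>r / norm q ^ i\<close>. The double sum runs over the poles \<open>a / q ^ m\<close> of \<open>kernel\<close> inside that
  circle.\<close>

lemma circle_integral_shifted_kernel:
  assumes "r > 0" "sphere 0 r \<subseteq> - q_orbits"
  shows "contour_integral (circlepath 0 r) (shifted_kernel i) =
    2 * pi * \<i> * (residue kernel 0 +
      (\<Sum>a\<in>base_points. \<Sum>m | norm a * norm q ^ i < r * norm q ^ m. residue kernel (a / q ^ m)))"
proof -
  define D where "D s = (SIGMA a:base_points. {m. norm a * norm q ^ i < s * norm q ^ m})" for s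
  define f where "f = (\<lambda>(a, m). a * q ^ i / q ^ m)"
  have pos: "0 < norm a * norm q ^ i" if "a \<in> base_points" for a
  proof -
    have "a \<noteq> 0" using that zero_notin_base_points by metis
    then show ?thesis using q_nz by simp
  qed
  then have finD: "finite (D s)" for s
    unfolding D_def using finite_base_points q_nz q_lt_1
    by (intro finite_SigmaI finite_geometric_gt) auto
  have norm_f: "norm (f (a, m)) < s \<longleftrightarrow> norm a * norm q ^ i < s * norm q ^ m" for a m s
    using q_nz by (simp add: f_def norm_mult norm_divide norm_power field_simps)
  have f_q_orbits: "f p \<in> q_orbits" if "p \<in> D s" for p s
    using that pole_in_q_orbits by (auto simp: D_def f_def)
  have f_nz: "f p \<noteq> 0" if "p \<in> D s" for p s
    using that q_nz zero_notin_base_points by (auto simp: D_def f_def)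
  have inj: "inj_on f (D s)" for s
    using poles_distinct by (auto simp: inj_on_def D_def f_def)
  \<comment> \<open>The residue theorem is applied on a slightly larger disc; the poles outside the circle do not contribute.\<close>
  define pts where "pts = insert 0 (f ` D (r + 1))"
  have "contour_integral (circlepath 0 r) (shifted_kernel i) =
      2 * pi * \<i> * (\<Sum>p\<in>pts. winding_number (circlepath 0 r) p * residue (shifted_kernel i) p)"
  proof (rule Residue_theorem[of "ball 0 (r + 1)"])
    show "finite pts" by (simp add: pts_def finD)
    show "shifted_kernel i holomorphic_on ball 0 (r + 1) - pts"
    proof (rule holomorphic_shifted_kernel)
      fix a m assume "a \<in> base_points"
      then have "a * q ^ i / q ^ m \<in> ball 0 (r + 1) \<Longrightarrow> (a, m) \<in> D (r + 1)"
        using norm_f[of a m "r + 1"] by (simp add: D_def f_def)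
      then show "a * q ^ i / q ^ m \<notin> ball 0 (r + 1) - pts"
        by (force simp: pts_def f_def)
    qed (simp add: pts_def)
    show "path_image (circlepath 0 r) \<subseteq> ball 0 (r + 1) - pts"
      using assms f_q_orbits zero_in_q_orbits by (auto simp: pts_def)
    show "\<forall>w. w \<notin> ball 0 (r + 1) \<longrightarrow> winding_number (circlepath 0 r) w = 0"
      using assms(1)
      by (intro allI impI winding_number_zero_outside[of _ "ball 0 (r + 1)"]) auto
  qed auto
  also have "(\<Sum>p\<in>pts. winding_number (circlepath 0 r) p * residue (shifted_kernel i) p) =
      (\<Sum>p\<in>insert 0 (f ` D r). winding_number (circlepath 0 r) p * residue (shifted_kernel i) p)"
  proof (rule sum.mono_neutral_right)
    show "finite pts" by (simp add: pts_def finD)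
    have "D r \<subseteq> D (r + 1)"
    proof -
      have "r * norm q ^ m \<le> (r + 1) * norm q ^ m" for m
        by (intro mult_right_mono) auto
      then show ?thesis
        unfolding D_def by (intro Sigma_mono subsetI CollectI order_refl) (blast intro: less_le_trans)
    qed
    then show "insert 0 (f ` D r) \<subseteq> pts" by (auto simp: pts_def)
    show "\<forall>p\<in>pts - insert 0 (f ` D r). winding_number (circlepath 0 r) p * residue (shifted_kernel i) p = 0"
    proof
      fix p assume p: "p \<in> pts - insert 0 (f ` D r)"
      then obtain a m where am: "(a, m) \<in> D (r + 1)" "p = f (a, m)" by (auto simp: pts_def)
      then have "(a, m) \<notin> D r" using p by auto
      then have "\<not> norm p < r" using am by (simp add: norm_f D_def)
      moreover have "p \<in> q_orbits" using am f_q_orbits by simp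
      then have "norm p \<noteq> r" using assms(2) by auto
      ultimately have "winding_number (circlepath 0 r) p = 0"
        using assms(1) by (intro winding_number_zero_outside[of _ "cball 0 r"]) auto
      then show "winding_number (circlepath 0 r) p * residue (shifted_kernel i) p = 0" by simp
    qed
  qed
  also have "\<dots> = (\<Sum>p\<in>insert 0 (f ` D r). residue (shifted_kernel i) p)"
  proof (rule sum.cong)
    fix p assume "p \<in> insert 0 (f ` D r)"
    then have "norm p < r" using assms(1) by (auto simp: norm_f D_def)
    then have "winding_number (circlepath 0 r) p = 1"
      by (intro winding_number_circlepath) simp
    then show "winding_number (circlepath 0 r) p * residue (shifted_kernel i) p = residue (shifted_kernel i) p" by simp
  qed simp
  also have "\<dots> = residue (shifted_kernel i) 0 + (\<Sum>p\<in>f ` D r. residue (shifted_kernel i) p)"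
    using f_nz by (subst sum.insert) (auto simp: finD)
  also have "(\<Sum>p\<in>f ` D r. residue (shifted_kernel i) p) = (\<Sum>(a, m)\<in>D r. residue (shifted_kernel i) (f (a, m)))"
    by (subst sum.reindex[OF inj]) (simp add: case_prod_unfold)
  also have "\<dots> = (\<Sum>(a, m)\<in>D r. residue kernel (a / q ^ m))"
  proof (intro sum.cong refl, clarify)
    fix a m assume am: "(a, m) \<in> D r"
    have eq: "f (a, m) / q ^ i = a / q ^ m" using q_nz by (simp add: f_def)
    have "a / q ^ m \<in> q_orbits" using am pole_in_q_orbits[of a 0 m] by (simp add: D_def)
    then show "residue (shifted_kernel i) (f (a, m)) = residue kernel (a / q ^ m)"
      using residue_shifted_kernel[of "f (a, m)" i] f_nz[OF am] eq by simp
  qed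
  also have "\<dots> = (\<Sum>a\<in>base_points. \<Sum>m | norm a * norm q ^ i < r * norm q ^ m. residue kernel (a / q ^ m))"
    unfolding D_def using finite_base_points pos q_nz q_lt_1
    by (intro sum.Sigma[symmetric] ballI finite_geometric_gt) auto
  finally show ?thesis by (simp add: residue_shifted_kernel_0)
qed

text \<open>The sum of all residues of \<open>kernel(s) ds\<close> in the plane vanishes, because the integrals
  over large circles tend to \<open>0\<close>: they are the integrals of \<open>shifted_kernel i\<close> over one fixed circle
  around \<open>0\<close>, and these are the terms of a convergent series. The radius of that circle only has to
  avoid the countably many absolute values of points of \<open>q_orbits\<close>. Each point of \<open>base_points\<close>
  contributes the partial sums of its own convergent series of residues, so the growing sets of
  enclosed poles need no common description.\<close>

lemma residue_kernel_0_plus_residues_kernel_sum: "residue kernel 0 + (\<Sum>a\<in>base_points. residue kernel_sum a) = 0"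
proof -
  have "countable (norm ` q_orbits)" using countable_q_orbits by simp
  moreover have "uncountable {0<..<1::real}" by (simp add: uncountable_open_interval)
  ultimately have "\<not> {0<..<1} \<subseteq> norm ` q_orbits"
    using countable_subset by blast
  then obtain r where "r \<in> {0<..<1}" and r_notin: "r \<notin> norm ` q_orbits" by blast
  then have r: "0 < r" by simp
  have sphere: "sphere 0 r \<subseteq> - q_orbits" using r_notin by auto
  have "(\<lambda>i. contour_integral (circlepath 0 r) (shifted_kernel i)) \<longlonglongrightarrow> 0"
    using circle_integral_sums[OF r sphere] by (intro summable_LIMSEQ_zero sums_summable)
  moreover have "(\<lambda>i. contour_integral (circlepath 0 r) (shifted_kernel i)) \<longlonglongrightarrow>
      2 * pi * \<i> * (residue kernel 0 + (\<Sum>a\<in>base_points. residue kernel_sum a))"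
    unfolding circle_integral_shifted_kernel[OF r sphere]
  proof (intro tendsto_intros sum_geometric_threshold residue_kernel_sum_sums r)
    show "0 < norm a" if "a \<in> base_points" for a using that zero_notin_base_points by auto
  qed (use q_nz q_lt_1 in auto)
  ultimately have "2 * pi * \<i> * (residue kernel 0 + (\<Sum>a\<in>base_points. residue kernel_sum a)) = 0"
    using LIMSEQ_unique by blast
  then show ?thesis by simp
qed

text \<open>The domain for the residue theorem omits \<open>0\<close> and all poles outside \<open>base_points\<close>. Around
  these infinitely many points the winding number is \<open>0\<close>, so only the finitely many residues at
  \<open>base_points\<close> remain. The domain is connected because a countable set does not separate the
  plane.\<close>

lemma contour_integral_kernel_sum:
  assumes "valid_path \<gamma>" "pathfinish \<gamma> = pathstart \<gamma>" "path_image \<gamma> \<subseteq> - q_orbits"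
    and "\<And>w. w \<in> q_orbits \<Longrightarrow> winding_number \<gamma> w = (if w \<in> base_points then 1 else 0)"
  shows "contour_integral \<gamma> kernel_sum = - (2 * pi * \<i>) * residue kernel 0"
proof -
  have "contour_integral \<gamma> kernel_sum = 2 * pi * \<i> * (\<Sum>a\<in>base_points. winding_number \<gamma> a * residue kernel_sum a)"
  proof (rule Residue_theorem[of "- (q_orbits - base_points)"])
    show "open (- (q_orbits - base_points))" using zero_in_q_orbits zero_notin_base_points by (intro open_Compl_subset_q_orbits) auto
    have "countable (q_orbits - base_points)" using countable_q_orbits by simp
    then have "path_connected (- (q_orbits - base_points))"
      using path_connected_complement_countable[of "q_orbits - base_points"] by (simp add: Compl_eq_Diff_UNIV)
    then show "connected (- (q_orbits - base_points))" by (rule path_connected_imp_connected)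
    have "- (q_orbits - base_points) - base_points = - q_orbits" using base_points_subset_q_orbits by auto
    then show "kernel_sum holomorphic_on - (q_orbits - base_points) - base_points" "path_image \<gamma> \<subseteq> - (q_orbits - base_points) - base_points"
      using holomorphic_kernel_sum assms(3) by auto
  qed (use assms finite_base_points in auto)
  also have "(\<Sum>a\<in>base_points. winding_number \<gamma> a * residue kernel_sum a) = (\<Sum>a\<in>base_points. residue kernel_sum a)"
    using assms(4) base_points_subset_q_orbits by (intro sum.cong) auto
  also have "\<dots> = - residue kernel 0"
    using residue_kernel_0_plus_residues_kernel_sum by (simp add: eq_neg_iff_add_eq_0 add.commute)
  finally show ?thesis by simp
qed

end

section \<open>The residue at the origin\<close>

context q_kernel
begin

lemma inverse_qpoch_prod_has_fps_expansion:
  "(\<lambda>s. 1 / qpoch_prod s) has_fps_expansion (\<Prod>j=1..l+1. Abs_fps (\<lambda>m. z j ^ m / q_fact q (int m)))"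
proof -
  have "(\<lambda>s. 1 / qpoch q (s * c)) has_fps_expansion Abs_fps (\<lambda>m. c ^ m / q_fact q (int m))" for c
  proof -
    have "(\<lambda>s. c * s) has_fps_expansion fps_const c * fps_X"
      by (intro fps_expansion_intros)
    from has_fps_expansion_compose[OF q_binomial_expansion[OF q_lt_1] this]
    have "(\<lambda>s. 1 / qpoch q (s * c)) has_fps_expansion
        (Abs_fps (\<lambda>m. 1 / q_fact q (int m)) oo (fps_const c * fps_X))"
      by (simp add: o_def mult.commute)
    also have "Abs_fps (\<lambda>m. 1 / q_fact q (int m)) oo (fps_const c * fps_X) =
        Abs_fps (\<lambda>m. c ^ m / q_fact q (int m))"
      by (simp add: fps_eq_iff)
    finally show ?thesis .
  qed
  then have "(\<lambda>s. \<Prod>j=1..l+1. 1 / qpoch q (s * z j)) has_fps_expansion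
      (\<Prod>j=1..l+1. Abs_fps (\<lambda>m. z j ^ m / q_fact q (int m)))"
    by (intro has_fps_expansion_prod)
  moreover have "(\<Prod>j=1..l+1. 1 / qpoch q (s * z j)) = 1 / qpoch_prod s" for s
    unfolding qpoch_prod_def by (simp only: prod_dividef prod.neutral_const)
  ultimately show ?thesis by simp
qed

text \<open>For \<open>n \<ge> 0\<close> the residue at \<open>0\<close> of \<open>kernel s = s powi (- n - 1) / qpoch_prod s\<close> is
  the coefficient of \<open>s ^ n\<close> in the power series of \<open>1 / qpoch_prod\<close>, a Cauchy product of \<open>l + 1\<close>
  series. For \<open>n < 0\<close> there is no pole.\<close>

lemma residue_kernel_0:
  "residue kernel 0 = (if n < 0 then 0 else
     \<Sum>X\<in>multisets_of_size {1..l+1} (nat n). \<Prod>j=1..l+1. z j ^ count X j / q_fact q (int (count X j)))"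
proof (cases "n < 0")
  case True
  define U where "U = {s. qpoch_prod s \<noteq> 0}"
  have "open U"
    unfolding U_def by (rule open_qpoch_prod_nz)
  moreover have "0 \<in> U" by (simp add: U_def qpoch_prod_0)
  moreover have "kernel holomorphic_on U"
    unfolding kernel_def[abs_def] using True
    by (intro holomorphic_intros holomorphic_qpoch_prod) (auto simp: U_def)
  ultimately show ?thesis using True residue_holo by auto
next
  case False
  have "kernel s = 1 / qpoch_prod s / s ^ Suc (nat n)" for s
  proof -
    have "- n - 1 = - int (Suc (nat n))" using False by simp
    then have "s powi (- n - 1) = inverse (s ^ Suc (nat n))"
      by (simp only: power_int_minus power_int_of_nat)
    then show ?thesis by (simp add: kernel_def divide_inverse mult.commute)
  qed
  then have "residue kernel 0 = residue (\<lambda>s. 1 / qpoch_prod s / s ^ Suc (nat n)) 0"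
    by presburger
  also have "\<dots> = fps_nth (\<Prod>j=1..l+1. Abs_fps (\<lambda>m. z j ^ m / q_fact q (int m))) (nat n)"
    by (rule residue_fps_expansion_over_power_at_0[OF inverse_qpoch_prod_has_fps_expansion])
  also have "\<dots> = (\<Sum>X\<in>multisets_of_size {1..l+1} (nat n).
      \<Prod>j=1..l+1. z j ^ count X j / q_fact q (int (count X j)))"
    by (simp only: fps_prod_nth'[OF finite_atLeastAtMost] fps_nth_Abs_fps)
  finally show ?thesis using False by simp
qed

end

section \<open>Interlacing arrays with top row \<open>(N + k, k, \<dots>, k)\<close>\<close>

lemma prod_eq_first:
  fixes f :: "nat \<Rightarrow> 'a::comm_monoid_mult"
  assumes "1 \<le> m" "\<And>i. 2 \<le> i \<Longrightarrow> i \<le> m \<Longrightarrow> f i = 1"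
  shows "(\<Prod>i=1..m. f i) = f 1"
proof -
  have "(\<Prod>i=1..m. f i) = (\<Prod>i\<in>{1}. f i)"
    using assms by (intro prod.mono_neutral_right) auto
  then show ?thesis by simp
qed

text \<open>Multisets over \<open>{1..l+1}\<close> record by how much the first entry grows from each row to the
  next. When the top row is \<open>(N + k, k, \<dots>, k)\<close>, interlacing forces all entries outside the
  first column to be \<open>k\<close>, so an array amounts to such a multiset of size \<open>N\<close>, and the two maps below
  are mutually inverse. The values outside the triangle are those that \<open>GT_arrays\<close>
  prescribes.\<close>

definition content_array :: "nat \<Rightarrow> int \<Rightarrow> nat multiset \<Rightarrow> nat \<Rightarrow> nat \<Rightarrow> int" where
  "content_array l k X r i =
     (if 1 \<le> i \<and> i \<le> r \<and> r \<le> l + 1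
      then if i = 1 then k + (\<Sum>j=1..r. int (count X j)) else k else 0)"

definition array_content :: "nat \<Rightarrow> int \<Rightarrow> (nat \<Rightarrow> nat \<Rightarrow> int) \<Rightarrow> nat multiset" where
  "array_content l k P =
     (\<Sum>j=1..l+1. replicate_mset (nat (P j 1 - (if j = 1 then k else P (j - 1) 1))) j)"

lemma count_array_content:
  "count (array_content l k P) j =
     (if j \<in> {1..l+1} then nat (P j 1 - (if j = 1 then k else P (j - 1) 1)) else 0)"
proof -
  have "count (array_content l k P) j =
      (\<Sum>i=1..l+1. if i = j then nat (P j 1 - (if j = 1 then k else P (j - 1) 1)) else 0)"
    unfolding array_content_def count_sum by (intro sum.cong) auto
  then show ?thesis by (simp only: sum.delta[OF finite_atLeastAtMost])
qed

lemma sum_count_multisets_of_size: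
  fixes X :: "nat multiset"
  assumes "X \<in> multisets_of_size {1..l+1} N"
  shows "(\<Sum>j=1..l+1. int (count X j)) = int N"
proof -
  have "(\<Sum>j\<in>set_mset X. count X j) = (\<Sum>j=1..l+1. count X j)"
    using assms by (intro sum.mono_neutral_left) (auto simp: multisets_of_size_def count_eq_zero_iff)
  then have "(\<Sum>j=1..l+1. count X j) = N"
    using assms by (simp add: multisets_of_size_def size_multiset_overloaded_eq)
  then show ?thesis by (simp flip: of_nat_sum)
qed

context
  fixes l N :: nat and k :: int and p :: "nat \<Rightarrow> int"
  defines "p \<equiv> \<lambda>i. if i = 1 then int N + k else k"
begin

text \<open>Descending from the top row: an entry outside the first column is squeezed between two
  entries of the row above that are both \<open>k\<close>.\<close>

lemma hook_array_entry:
  assumes P: "P \<in> GT_arrays l p" and "2 \<le> i" "i \<le> r" "r \<le> l + 1"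
  shows "P r i = k"
  using \<open>r \<le> l + 1\<close> \<open>2 \<le> i\<close> \<open>i \<le> r\<close>
proof (induction arbitrary: i rule: inc_induct)
  case base
  then show ?case using P by (auto simp: GT_arrays_def p_def)
next
  case (step r)
  then have "P (Suc r) i = k" "P (Suc r) (Suc i) = k" by auto
  moreover have "P (Suc r) i \<ge> P r i \<and> P r i \<ge> P (Suc r) (Suc i)"
  proof -
    have "r \<in> {1..l}" "i \<in> {1..r}" using step by auto
    then show ?thesis using P unfolding GT_arrays_def Suc_eq_plus1 by blast
  qed
  ultimately show ?case by simp
qed

lemma hook_array_first_column:
  assumes P: "P \<in> GT_arrays l p" and "1 \<le> l"
  shows "k \<le> P 1 1" "P (l + 1) 1 = int N + k" "\<And>r. r \<in> {1..l} \<Longrightarrow> P r 1 \<le> P (r + 1) 1"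
proof -
  have "P 2 2 = k" using assms by (intro hook_array_entry) auto
  moreover have "P 1 1 \<ge> P (1 + 1) (1 + 1)" using assms unfolding GT_arrays_def by fastforce
  ultimately show "k \<le> P 1 1" by (simp add: numeral_2_eq_2)
  show "P (l + 1) 1 = int N + k" using P by (auto simp: GT_arrays_def p_def)
  show "P r 1 \<le> P (r + 1) 1" if "r \<in> {1..l}" for r
    using P that unfolding GT_arrays_def by auto
qed

lemma sum_count_array_content:
  assumes P: "P \<in> GT_arrays l p" and "1 \<le> l" "1 \<le> r" "r \<le> l + 1"
  shows "(\<Sum>j=1..r. int (count (array_content l k P) j)) = P r 1 - k"
  using \<open>1 \<le> r\<close> \<open>r \<le> l + 1\<close>
proof (induction r rule: dec_induct)
  case base
  then show ?case
    using hook_array_first_column(1)[OF P \<open>1 \<le> l\<close>] by (simp add: count_array_content)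
next
  case (step r)
  have "P r 1 \<le> P (r + 1) 1"
    using hook_array_first_column(3)[OF P \<open>1 \<le> l\<close>] step by simp
  then have "int (count (array_content l k P) (Suc r)) = P (Suc r) 1 - P r 1"
    using step by (auto simp: count_array_content)
  then show ?case using step by simp
qed

lemma bij_betw_content_array:
  assumes "1 \<le> l"
  shows "bij_betw (content_array l k) (multisets_of_size {1..l+1} N) (GT_arrays l p)"
proof (rule bij_betw_byWitness[where f' = "array_content l k"])
  show "\<forall>X\<in>multisets_of_size {1..l+1} N. array_content l k (content_array l k X) = X"
  proof
    fix X assume X: "X \<in> multisets_of_size {1..l+1} N"
    show "array_content l k (content_array l k X) = X"
    proof (rule multiset_eqI)
      fix j
      show "count (array_content l k (content_array l k X)) j = count X j"
      proof (cases "j \<in> {1..l+1}")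
        case False
        then have "j \<notin># X" using X by (auto simp: multisets_of_size_def)
        then show ?thesis using False by (simp only: count_array_content if_False not_in_iff)
      next
        case True
        then obtain j' where "j = Suc j'" by (cases j) auto
        then show ?thesis using True by (auto simp: count_array_content content_array_def)
      qed
    qed
  qed
  show "\<forall>P\<in>GT_arrays l p. content_array l k (array_content l k P) = P"
  proof (intro ballI ext)
    fix P r i assume P: "P \<in> GT_arrays l p"
    show "content_array l k (array_content l k P) r i = P r i"
    proof (cases "1 \<le> i \<and> i \<le> r \<and> r \<le> l + 1")
      case True
      show ?thesis
      proof (cases "i = 1")
        case True
        then show ?thesis
          using sum_count_array_content[OF P assms, of r] \<open>1 \<le> i \<and> i \<le> r \<and> r \<le> l + 1\<close>
          unfolding content_array_def by simp
      next
        case False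
        then show ?thesis
          using hook_array_entry[OF P, of i r] True unfolding content_array_def by simp
      qed
    next
      case False
      then show ?thesis using P unfolding GT_arrays_def content_array_def by auto
    qed
  qed
  show "array_content l k ` GT_arrays l p \<subseteq> multisets_of_size {1..l+1} N"
  proof
    fix X assume "X \<in> array_content l k ` GT_arrays l p"
    then obtain P where P: "P \<in> GT_arrays l p" "X = array_content l k P" by blast
    have "set_mset X \<subseteq> {1..l+1}"
      unfolding P(2) by (auto simp: count_array_content simp flip: count_greater_zero_iff split: if_splits)
    moreover have "size X = N"
    proof -
      have "X \<in> multisets_of_size {1..l+1} (size X)"
        using calculation by (simp add: multisets_of_size_def)
      from sum_count_multisets_of_size[OF this] sum_count_array_content[OF P(1) assms, of "l + 1"]
        hook_array_first_column(2)[OF P(1) assms]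
      show ?thesis by (simp add: P(2))
    qed
    ultimately show "X \<in> multisets_of_size {1..l+1} N" by (simp add: multisets_of_size_def)
  qed
  show "content_array l k ` multisets_of_size {1..l+1} N \<subseteq> GT_arrays l p"
  proof
    fix P assume "P \<in> content_array l k ` multisets_of_size {1..l+1} N"
    then obtain X where X: "X \<in> multisets_of_size {1..l+1} N" "P = content_array l k X" by blast
    show "P \<in> GT_arrays l p"
      unfolding GT_arrays_def
    proof (intro CollectI conjI ballI allI impI)
      show "P (l + 1) i = p i" if "i \<in> {1..l+1}" for i
        using that sum_count_multisets_of_size[OF X(1)] by (simp add: X(2) content_array_def p_def)
      show "P r i \<le> P (r + 1) i" "P (r + 1) (i + 1) \<le> P r i" if "r \<in> {1..l}" "i \<in> {1..r}" for r i
        using that by (auto simp: X(2) content_array_def sum_nonneg)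
      show "P r i = 0" if "\<not> (1 \<le> i \<and> i \<le> r \<and> r \<le> l + 1)" for r i
        using that by (simp only: X(2) content_array_def if_False)
    qed
  qed
qed

text \<open>Only the differences involving the first column contribute \<open>q\<close>-factorials different from
  \<open>1\<close>. The factors belonging to the sums of the first \<open>r\<close> multiplicities cancel for
  \<open>2 \<le> r \<le> l\<close>, where they occur once in the numerator and once in the denominator; for
  \<open>r = 1\<close> such a factor only occurs in the denominator, and it belongs to the first multiplicity
  itself.\<close>

lemma content_array_weight:
  fixes X :: "nat multiset"
  assumes q: "norm q < 1" and z: "\<And>j. j \<in> {1..l+1} \<Longrightarrow> z j \<noteq> 0" and "1 \<le> l"
  defines "P \<equiv> content_array l k X"
  shows "(\<Prod>r=1..l+1. z r powi ((\<Sum>i=1..r. P r i) - (\<Sum>i=1..r-1. P (r-1) i))) *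
       ((\<Prod>r=2..l. \<Prod>i=1..r-1. q_fact q (P r i - P r (i+1))) /
        (\<Prod>r=1..l. \<Prod>i=1..r. q_fact q (P (r+1) i - P r i) * q_fact q (P r i - P (r+1) (i+1)))) =
     (\<Prod>j=1..l+1. z j powi k) * (\<Prod>j=1..l+1. z j ^ count X j / q_fact q (int (count X j)))"
proof -
  define c where "c j = int (count X j)" for j
  define C where "C r = (\<Sum>j=1..r. c j)" for r
  have P1: "P r 1 = k + C r" if "1 \<le> r" "r \<le> l + 1" for r
    using that by (simp add: P_def content_array_def C_def c_def)
  have P2: "P r i = k" if "2 \<le> i" "i \<le> r" "r \<le> l + 1" for r i
    using that by (simp add: P_def content_array_def)
  have q0: "q_fact q 0 = 1" by (simp add: q_fact_def)
  have row_sum: "(\<Sum>i=1..r. P r i) = int r * k + C r" if "r \<le> l + 1" for r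
  proof (cases r)
    case 0
    then show ?thesis by (simp add: C_def)
  next
    case (Suc r')
    have "(\<Sum>i=1..r. P r i) = P r 1 + (\<Sum>i=2..r. P r i)"
      using Suc by (simp add: sum.atLeast_Suc_atMost numeral_2_eq_2)
    also have "(\<Sum>i=2..r. P r i) = (\<Sum>i=2..r. k)"
      using that by (intro sum.cong) (auto simp: P2)
    finally show ?thesis using P1[of r] Suc that by (simp add: algebra_simps)
  qed
  have "z r powi ((\<Sum>i=1..r. P r i) - (\<Sum>i=1..r-1. P (r-1) i)) = z r powi k * z r ^ count X r"
    if r: "r \<in> {1..l+1}" for r
  proof -
    obtain r' where r': "r = Suc r'" using r by (cases r) auto
    have "(\<Sum>i=1..r. P r i) - (\<Sum>i=1..r-1. P (r-1) i) = k + int (count X r)"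
      using r row_sum[of r] row_sum[of r'] by (simp add: r' C_def c_def algebra_simps)
    then show ?thesis using z[OF r] by (simp add: power_int_add)
  qed
  then have 1: "(\<Prod>r=1..l+1. z r powi ((\<Sum>i=1..r. P r i) - (\<Sum>i=1..r-1. P (r-1) i))) =
      (\<Prod>j=1..l+1. z j powi k) * (\<Prod>j=1..l+1. z j ^ count X j)"
    by (simp only: prod.distrib cong: prod.cong)
  have 2: "(\<Prod>r=2..l. \<Prod>i=1..r-1. q_fact q (P r i - P r (i+1))) = (\<Prod>r=2..l. q_fact q (C r))"
  proof (rule prod.cong)
    fix r assume r: "r \<in> {2..l}"
    have "(\<Prod>i=1..r-1. q_fact q (P r i - P r (i+1))) = q_fact q (P r 1 - P r (1+1))"
      using r by (intro prod_eq_first) (auto simp: P2 q0)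
    also have "\<dots> = q_fact q (C r)" using r P1[of r] P2[of 2 r] by (simp add: numeral_2_eq_2)
    finally show "(\<Prod>i=1..r-1. q_fact q (P r i - P r (i+1))) = q_fact q (C r)" .
  qed simp
  have 3: "(\<Prod>r=1..l. \<Prod>i=1..r. q_fact q (P (r+1) i - P r i) * q_fact q (P r i - P (r+1) (i+1))) =
      (\<Prod>r=1..l. q_fact q (c (Suc r)) * q_fact q (C r))"
  proof (rule prod.cong)
    fix r assume r: "r \<in> {1..l}"
    have "(\<Prod>i=1..r. q_fact q (P (r+1) i - P r i) * q_fact q (P r i - P (r+1) (i+1))) =
        q_fact q (P (r+1) 1 - P r 1) * q_fact q (P r 1 - P (r+1) (1+1))"
      using r by (intro prod_eq_first) (auto simp: P2 q0)
    also have "P (r+1) 1 - P r 1 = c (Suc r)" using r P1[of r] P1[of "r+1"] by (simp add: C_def)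
    also have "P r 1 - P (r+1) (1+1) = C r" using r P1[of r] P2[of 2 "r+1"] by (simp add: numeral_2_eq_2)
    finally show "(\<Prod>i=1..r. q_fact q (P (r+1) i - P r i) * q_fact q (P r i - P (r+1) (i+1))) =
        q_fact q (c (Suc r)) * q_fact q (C r)" .
  qed simp
  have 4: "(\<Prod>r=1..l. q_fact q (C r)) = q_fact q (c 1) * (\<Prod>r=2..l. q_fact q (C r))"
    using \<open>1 \<le> l\<close> by (simp add: prod.atLeast_Suc_atMost numeral_2_eq_2 C_def)
  have 5: "(\<Prod>j=1..l+1. q_fact q (c j)) = q_fact q (c 1) * (\<Prod>r=1..l. q_fact q (c (Suc r)))"
    using prod.atLeast_Suc_atMost[of 1 "l + 1" "\<lambda>j. q_fact q (c j)"]
      prod.shift_bounds_cl_Suc_ivl[of "\<lambda>j. q_fact q (c j)" 1 l]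
    by (simp del: prod.cl_ivl_Suc)
  have nz: "(\<Prod>r=2..l. q_fact q (C r)) \<noteq> 0" by (simp add: q_fact_nz[OF q])
  have "(\<Prod>r=2..l. q_fact q (C r)) / (\<Prod>r=1..l. q_fact q (c (Suc r)) * q_fact q (C r)) =
      1 / (\<Prod>j=1..l+1. q_fact q (c j))"
    unfolding prod.distrib 4 5 using nz by (simp del: prod.cl_ivl_Suc)
  then show ?thesis
    unfolding 1 2 3 by (simp only: prod_dividef c_def) simp
qed

lemma q_Whittaker_hook:
  assumes "norm q < 1" "\<And>j. j \<in> {1..l+1} \<Longrightarrow> z j \<noteq> 0" "1 \<le> l"
  shows "q_Whittaker q l z p = (\<Prod>j=1..l+1. z j powi k) *
    (\<Sum>X\<in>multisets_of_size {1..l+1} N. \<Prod>j=1..l+1. z j ^ count X j / q_fact q (int (count X j)))"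
proof -
  have "\<forall>i\<in>{1..l}. p (i + 1) \<le> p i" by (auto simp: p_def)
  then show ?thesis
    by (simp only: q_Whittaker_def if_P
          sum.reindex_bij_betw[OF bij_betw_content_array[OF \<open>1 \<le> l\<close>], symmetric]
          content_array_weight[OF assms] sum_distrib_left)
qed

end

section \<open>The pairing\<close>

context q_kernel
begin

lemma shifted_kernel_eq:
  assumes "t \<noteq> 0"
  shows "shifted_kernel i t = kernel t *
    (q powi (n * int i) * (1 / (\<Prod>j=1..l+1. \<Prod>m=1..i. 1 - t * z j * q powi (- int m))))"
proof (induction i)
  case 0
  then show ?case by (simp add: shifted_kernel_def)
next
  case (Suc i)
  have "1 - t * z j / q ^ Suc i = 1 - t * z j * q powi (- int (Suc i))" for j
    by (simp only: power_int_minus power_int_of_nat divide_inverse)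
  moreover have "(\<Prod>m=1..Suc i. 1 - t * z j * q powi (- int m)) =
      (\<Prod>m=1..i. 1 - t * z j * q powi (- int m)) * (1 - t * z j * q powi (- int (Suc i)))" for j
    by (simp add: atLeastAtMostSuc_conv mult.commute)
  moreover have "q powi (n * int (Suc i)) = q powi (n * int i) * q powi n"
    using q_nz by (simp add: power_int_add distrib_left mult.commute)
  ultimately show ?case
    by (simp only: shifted_kernel_Suc[OF assms] Suc prod.distrib) simp
qed

text \<open>The product in the \<open>i\<close>-th term of \<open>I_fun\<close> supplies the factors of
  \<open>qpoch_prod (t / q ^ i)\<close> that \<open>qpoch_prod t\<close> lacks, and \<open>L_tilde\<close> together with the denominator of
  the pairing is \<open>1 / qpoch_prod t\<close>.\<close>

lemma pairing_integrand_eq: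
  assumes "t \<notin> q_orbits"
  shows "1 / t * (I_fun q l z n k t * L_tilde q l z t / (\<Prod>j=1..l+1. 1 - t * z j)) =
    (\<Prod>j=1..l+1. z j powi k) * kernel_sum t"
proof -
  define T where
    "T i = q powi (n * int i) * (1 / (\<Prod>j=1..l+1. \<Prod>m=1..i. 1 - t * z j * q powi (- int m)))" for i
  have "t \<noteq> 0" using assms zero_in_q_orbits by auto
  have "qpoch_prod t \<noteq> 0" using assms pole_in_q_orbits[of _ 0] by (auto simp: qpoch_prod_eq_0_iff)
  then have kernel_nz: "kernel t \<noteq> 0" using \<open>t \<noteq> 0\<close> by (simp add: kernel_def)
  have shifted_kernel: "shifted_kernel i t = kernel t * T i" for i
    unfolding T_def by (rule shifted_kernel_eq[OF \<open>t \<noteq> 0\<close>])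
  have "summable (\<lambda>i. kernel t * T i)"
    using shifted_kernel_sums_kernel_sum[OF assms] unfolding shifted_kernel by (rule sums_summable)
  then have "kernel_sum t = kernel t * (\<Sum>i. T i)"
    unfolding kernel_sum_def shifted_kernel using kernel_nz by (simp add: summable_cmult_iff suminf_mult)
  moreover have "kernel t = 1 / t * t powi (- n) * (L_tilde q l z t / (\<Prod>j=1..l+1. 1 - t * z j))"
  proof -
    have "qpoch_prod t = (\<Prod>j=1..l+1. (1 - t * z j) * qpoch q (t * z j * q))"
      unfolding qpoch_prod_def by (intro prod.cong refl qpoch_rec q_lt_1)
    then have "1 / qpoch_prod t = L_tilde q l z t / (\<Prod>j=1..l+1. 1 - t * z j)"
      by (simp only: L_tilde_eq prod.distrib) simp
    moreover have "t powi (- n - 1) = 1 / t * t powi (- n)"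
      using \<open>t \<noteq> 0\<close> by (simp add: power_int_diff)
    ultimately show ?thesis by (simp add: kernel_def divide_inverse)
  qed
  moreover have "I_fun q l z n k t = (\<Prod>j=1..l+1. z j powi k) * t powi (- n) * (\<Sum>i. T i)"
    unfolding I_fun_def T_def ..
  ultimately show ?thesis by (simp only:) (simp add: divide_inverse mult_ac)
qed

end

lemma (in q_kernel_nonresonant) K_pairing_eq_residue:
  assumes "valid_path \<gamma>" "pathfinish \<gamma> = pathstart \<gamma>" "path_image \<gamma> \<subseteq> - q_orbits"
    and "\<And>w. w \<in> q_orbits \<Longrightarrow> winding_number \<gamma> w = (if w \<in> base_points then 1 else 0)"
  shows "K_pairing \<gamma> l z (\<lambda>t. I_fun q l z n k t * L_tilde q l z t) =
    (\<Prod>j=1..l+1. z j powi k) * residue kernel 0"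
proof -
  let ?R = "\<lambda>t. 1 / t * (I_fun q l z n k t * L_tilde q l z t / (\<Prod>j=1..l+1. 1 - t * z j))"
  have "contour_integral \<gamma> ?R = contour_integral \<gamma> (\<lambda>t. (\<Prod>j=1..l+1. z j powi k) * kernel_sum t)"
    using assms(3) by (intro contour_integral_eq pairing_integrand_eq) auto
  also have "\<dots> = (\<Prod>j=1..l+1. z j powi k) * contour_integral \<gamma> kernel_sum"
    using assms
    by (intro contour_integral_lmul contour_integrable_holomorphic_simple[OF holomorphic_kernel_sum open_Compl_q_orbits])
  also have "contour_integral \<gamma> kernel_sum = - (2 * pi * \<i>) * residue kernel 0"
    by (rule contour_integral_kernel_sum[OF assms])
  also have "(\<Prod>j=1..l+1. z j powi k) * (- (2 * pi * \<i>) * residue kernel 0) =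
      - (2 * pi * \<i>) * ((\<Prod>j=1..l+1. z j powi k) * residue kernel 0)"
    by (simp only: mult_ac)
  finally have "K_pairing \<gamma> l z (\<lambda>t. I_fun q l z n k t * L_tilde q l z t) =
      - (1 / (2 * pi * \<i>)) * (- (2 * pi * \<i>) * ((\<Prod>j=1..l+1. z j powi k) * residue kernel 0))"
    unfolding K_pairing_def by simp
  also have "- (1 / c) * (- c * x) = x" if "c \<noteq> 0" for c x :: complex
    using that by simp
  then have "- (1 / (2 * pi * \<i>)) * (- (2 * pi * \<i>) * ((\<Prod>j=1..l+1. z j powi k) * residue kernel 0)) =
      (\<Prod>j=1..l+1. z j powi k) * residue kernel 0"
    by simp
  finally show ?thesis .
qed

theorem proposition5p1:
  fixes q :: complex and l :: nat and lam z :: "nat \<Rightarrow> complex" and n k :: int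
  assumes "q \<noteq> 0" and "norm q < 1" and "l \<ge> 1"
    and "\<And>j. j \<in> {1..l+1} \<Longrightarrow> z j = exp (lam j)"
  shows "(\<forall>t. (\<forall>j\<in>{1..l+1}. \<forall>m\<ge>1. 1 - t * z j * q ^ m \<noteq> 0) \<longrightarrow>
            L_tilde q l z t = (\<Prod>j=1..l+1. q_Gamma q (q * t * z j))) \<and>
         (\<forall>\<gamma>. is_C0 q l z \<gamma> \<longrightarrow>
            q_Whittaker_spec q l z n k =
              K_pairing \<gamma> l z (\<lambda>t. I_fun q l z n k t * L_tilde q l z t))"
proof (intro conjI allI impI)
  show "L_tilde q l z t = (\<Prod>j=1..l+1. q_Gamma q (q * t * z j))" for t
    using \<open>norm q < 1\<close> by (rule L_tilde_eq_prod_q_Gamma)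
next
  fix \<gamma> assume C0: "is_C0 q l z \<gamma>"
  have z_nz: "z j \<noteq> 0" if "j \<in> {1..l+1}" for j
    using assms(4)[OF that] by simp
  interpret q_kernel q l z n
    using assms z_nz by unfold_locales
  interpret q_kernel_nonresonant q l z n
  proof
    fix a b m assume "a \<in> base_points" "b \<in> base_points" "m \<noteq> (0::int)"
    then show "a \<noteq> b * q powi m"
      using is_C0_nonresonant[OF C0] by (auto simp only: base_points_def)
  qed
  \<comment> \<open>Points of \<open>q_orbits\<close> may be \<open>inverse (z j) * q powi m\<close> for several \<open>j\<close>, but nonresonance makes \<open>m\<close> unique.\<close>
  have winding: "w \<notin> path_image \<gamma> \<and> winding_number \<gamma> w = (if w \<in> base_points then 1 else 0)" if w: "w \<in> q_orbits" for w
  proof (cases "w = 0")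
    case True
    then show ?thesis using C0 zero_notin_base_points by (simp add: is_C0_def)
  next
    case False
    then obtain j m where jm: "j \<in> {1..l+1}" "w = inverse (z j) * q powi m"
    proof -
      obtain a m where "a \<in> base_points" "w = a * q powi m" using w False unfolding q_orbits_def by blast
      then show ?thesis using that unfolding base_points_def by blast
    qed
    have "w \<in> base_points \<longleftrightarrow> m = 0"
    proof
      assume "w \<in> base_points"
      moreover have "inverse (z j) \<in> base_points" using jm(1) by (simp only: base_points_def image_eqI)
      ultimately show "m = 0" using nonresonant jm(2) by blast
    next
      assume "m = 0"
      then show "w \<in> base_points" using jm by (simp only: base_points_def power_int_0_right mult_1_right image_eqI)
    qed
    moreover have "w \<notin> path_image \<gamma> \<and> winding_number \<gamma> w = (if m = 0 then 1 else 0)"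
      using C0 jm unfolding is_C0_def by blast
    ultimately show ?thesis by simp
  qed
  have pairing: "K_pairing \<gamma> l z (\<lambda>t. I_fun q l z n k t * L_tilde q l z t) =
      (\<Prod>j=1..l+1. z j powi k) * residue kernel 0"
    using C0 winding by (intro K_pairing_eq_residue) (auto simp: is_C0_def)
  show "q_Whittaker_spec q l z n k = K_pairing \<gamma> l z (\<lambda>t. I_fun q l z n k t * L_tilde q l z t)"
  proof (cases "n < 0")
    case True
    then have "\<not> (\<forall>i\<in>{1..l}. (if i + 1 = 1 then n + k else k) \<le> (if i = 1 then n + k else k))"
      using \<open>l \<ge> 1\<close> by (auto intro!: bexI[of _ 1])
    then have "q_Whittaker_spec q l z n k = 0"
      unfolding q_Whittaker_spec_def q_Whittaker_def by (rule if_not_P)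
    then show ?thesis unfolding pairing residue_kernel_0 using True by simp
  next
    case False
    then have "int (nat n) = n" by simp
    then have "q_Whittaker_spec q l z n k = q_Whittaker q l z (\<lambda>i. if i = 1 then int (nat n) + k else k)"
      by (simp only: q_Whittaker_spec_def)
    also have "\<dots> = (\<Prod>j=1..l+1. z j powi k) * residue kernel 0"
      unfolding residue_kernel_0 if_not_P[OF False]
      by (rule q_Whittaker_hook[of q l z "nat n" k, OF \<open>norm q < 1\<close> z_nz \<open>l \<ge> 1\<close>])
    finally show ?thesis unfolding pairing .
  qed
qed

end
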